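(* Let $n \geq 1$ and $0 \leq m \leq n-1$ such that either $m$ is even or $m = n-1$. Then $\Delta_{n,m}$ is partitionable, with \[\mathcal{F}(\Delta_{n,m}) = \bigsqcup_{\pi \in \Phi(\Delta_{n,m})} [C_\pi, C^\pi],\] and consequently \[h_j(\Delta_{n,m}) = |\{\pi \in \Phi(\Delta_{n,m}) : \operatorname{des}(\pi) = j\}|\] for each $0 \leq j \leq n$.
   Context: Sign vectors: elements of $\{-,0,+\}^n$. For a sign vector $\omega$, $\operatorname{var}(\omega)$ is the number of sign changes in the sequence obtained from $\omega$ by deleting its zero entries, and $\operatorname{wt}(\omega)$ its number of nonzero entries. $\mathcal{PV}_n$ is the set of nonzero sign vectors of length $n$ modulo $\omega \sim -\omega$. For $0 \leq m < n$, $P_{n,m}$ is the poset on $\{\omega \in \mathcal{PV}_n : \operatorname{var}(\omega) \leq m\}$ with $\omega' < \omega$ iff $\omega'$ or $-\omega'$ is obtained from $\omega$ by replacing some nonzero entries with $0$. $\Delta_{n,m}$ is the order complex of $P_{n,m}$ (faces = chains, including the empty chain); $\mathcal{F}(\Delta_{n,m})$ is its face poset ordered by inclusion, and $[A,B]$ denotes the interval $\{D : A \subseteq D \subseteq B\}$. A simplicial complex is partitionable if its face poset is a disjoint union, indexed by the facets $F$, of Boolean intervals $[G_F, F]$. The $h$-vector of a $(d-1)$-dimensional complex with $f_{i-1}$ faces of cardinality $i$ is given by $h_k = \sum_{i=0}^k (-1)^{k-i}\binom{d-i}{k-i} f_{i-1}$, $0 \leq k \leq d$. Cyclic sign flips: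 indices are read cyclically ($\omega_{i+n} = \omega_i$); $i \in [n]$ is a cyclic sign flip of $\omega$ if there is $j \geq 1$ with $\omega_{i-j}\omega_i < 0$ and $\omega_{i-k}\omega_i = 0$ for $1 \leq k < j$. $\operatorname{BAR}(\omega)$ is the set of cyclic sign flips; $\operatorname{BAR}(0^n) = \emptyset$. Signed permutations: bijections $\pi$ of $\{\pm 1, \dots, \pm n\}$ with $\pi(-i) = -\pi(i)$, in window notation $\pi(1)\cdots\pi(n)$. $S^D_n$: those with an even number of negative window entries. With $w_0 = 0$, $w_i = \pi(i)$, $\operatorname{Des}(\pi) = \{i \in \{0, \dots, n-1\} : w_i > w_{i+1}\}$ and $\operatorname{des}(\pi) = |\operatorname{Des}(\pi)|$. The map $\Phi$: for a chain $C: \omega^{(1)} < \cdots < \omega^{(r)}$ set $\omega^{(0)} = 0^n$. For $s = 1, \dots, r$ let $I_s = \{i \in [n] : \omega^{(s)}_i \neq 0, \omega^{(s-1)}_i = 0\}$, and $I_{r+1} = \{i \in [n] : \omega^{(r)}_i = 0\}$. For $1 \leq s \leq r+1$ let $\bar{I}_s = \{i : i \in I_s, i \notin \operatorname{BAR}(\omega^{(r)})\} \cup \{-i : i \in I_s, i \in \operatorname{BAR}(\omega^{(r)})\}$, and $\omega'_s$ the word listing $\bar{I}_s$ in increasing order. $\Phi(C)$ is the signed permutation with window notation $\omega'_{r+1}\cdots\omega'_1$; $\Phi(\Delta_{n,m})$ is the set of its values on faces of $\Delta_{n,m}$. The chains $C^\pi$ and $C_\pi$: for $\pi \in S^D_n$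 let $X$ be the set of absolute values of the negative window entries, and $\theta \in \mathcal{PV}_n$ the unique class with no zero entries and $\operatorname{BAR}(\theta) = X$. For $1 \leq j \leq n$ let $\omega^{(j)}$ be obtained from $\theta$ by setting to $0$ all entries outside $\{|\pi(n-j+1)|, \dots, |\pi(n)|\}$. Then $C^\pi: \omega^{(1)} < \cdots < \omega^{(n)}$ is a maximal chain, and $C_\pi$ is its subchain consisting of those $\omega^{(j)}$ with $\operatorname{wt}(\omega^{(j)}) = j \in \{n - i : i \in \operatorname{Des}(\pi)\}$. *)

theory Defs
  imports Main "HOL-Library.Disjoint_Sets" "HOL-Combinatorics.Permutations"
begin

section \<open>Simplicial complexes\<close>

text \<open>
  A finite abstract simplicial complex is given by its set of faces, including the empty face,
  so that the complex is also the carrier of its face poset (ordered by inclusion), and the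
  interval from \<open>A\<close> to \<open>B\<close> is the set interval \<open>{A..B}\<close>.
\<close>

definition facets :: "'a set set \<Rightarrow> 'a set set" where
  "facets \<Delta> = {F \<in> \<Delta>. \<forall>F'\<in>\<Delta>. F \<subseteq> F' \<longrightarrow> F' = F}"

definition partitionable :: "'a set set \<Rightarrow> bool" where
  "partitionable \<Delta> \<longleftrightarrow>
     (\<exists>G. (\<forall>F\<in>facets \<Delta>. G F \<subseteq> F) \<and>
          disjoint_family_on (\<lambda>F. {G F..F}) (facets \<Delta>) \<and>
          (\<Union>F\<in>facets \<Delta>. {G F..F}) = \<Delta>)"

text \<open>Here \<open>f_number \<Delta> i\<close> is $f_{i-1}$, and a complex of dimension $d-1$ has \<open>rank_of \<Delta> = d\<close>.\<close>

definition f_number :: "'a set set \<Rightarrow> nat \<Rightarrow> nat" where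
  "f_number \<Delta> i = card {F \<in> \<Delta>. card F = i}"

definition rank_of :: "'a set set \<Rightarrow> nat" where
  "rank_of \<Delta> = Max (card ` \<Delta>)"

definition h_number :: "'a set set \<Rightarrow> nat \<Rightarrow> int" where
  "h_number \<Delta> k =
     (\<Sum>i=0..k. (-1) ^ (k - i) * int ((rank_of \<Delta> - i) choose (k - i)) * int (f_number \<Delta> i))"


section \<open>Sign vectors\<close>

text \<open>
  A sign vector of length \<open>n\<close> is a function on the integers with values in \<open>{-1, 0, 1}\<close>,
  its entries being those at the positions \<open>1, \<dots>, n\<close>; outside these positions it is \<open>0\<close>,
  so that equality of functions is equality of sign vectors.
\<close>

type_synonym sign_vector = "int \<Rightarrow> int"

definition sign_vectors :: "nat \<Rightarrow> sign_vector set" where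
  "sign_vectors n = {\<omega>. (\<forall>i. \<omega> i \<in> {-1, 0, 1}) \<and> (\<forall>i. i \<notin> {1..int n} \<longrightarrow> \<omega> i = 0)}"

definition zero_sv :: sign_vector where
  "zero_sv = (\<lambda>i. 0)"

definition sv_var :: "nat \<Rightarrow> sign_vector \<Rightarrow> nat" where
  "sv_var n \<omega> =
     (let xs = filter (\<lambda>a. a \<noteq> 0) (map \<omega> [1..int n])
      in card {k. Suc k < length xs \<and> xs ! k * xs ! Suc k < 0})"

definition sv_supp :: "nat \<Rightarrow> sign_vector \<Rightarrow> int set" where
  "sv_supp n \<omega> = {i \<in> {1..int n}. \<omega> i \<noteq> 0}"

definition sv_zeroing :: "sign_vector \<Rightarrow> sign_vector \<Rightarrow> bool" where
  "sv_zeroing \<omega>' \<omega> \<longleftrightarrow> \<omega>' \<noteq> \<omega> \<and> (\<forall>i. \<omega>' i = \<omega> i \<or> \<omega>' i = 0)"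

definition cyc_index :: "nat \<Rightarrow> int \<Rightarrow> int" where
  "cyc_index n i = (i - 1) mod int n + 1"

definition sv_BAR :: "nat \<Rightarrow> sign_vector \<Rightarrow> int set" where
  "sv_BAR n \<omega> =
     {i \<in> {1..int n}. \<exists>j\<ge>1. \<omega> (cyc_index n (i - j)) * \<omega> i < 0 \<and>
        (\<forall>k. 1 \<le> k \<and> k < j \<longrightarrow> \<omega> (cyc_index n (i - k)) * \<omega> i = 0)}"


section \<open>Sign vectors modulo negation\<close>

definition neg_rel :: "nat \<Rightarrow> (sign_vector \<times> sign_vector) set" where
  "neg_rel n = {(\<omega>, \<omega>'). \<omega> \<in> sign_vectors n - {zero_sv} \<and>
                        \<omega>' \<in> sign_vectors n - {zero_sv} \<and>
                        (\<omega>' = \<omega> \<or> \<omega>' = (\<lambda>i. - \<omega> i))}"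

definition PV :: "nat \<Rightarrow> sign_vector set set" where
  "PV n = (sign_vectors n - {zero_sv}) // neg_rel n"

text \<open>
  \<open>sv_var\<close>, \<open>sv_supp\<close> and \<open>sv_BAR\<close> are invariant under negation, see the lemmas below. The two
  set-valued ones are lifted to classes by a union over the representatives.
\<close>

lemma sv_supp_uminus: "sv_supp n (\<lambda>i. - \<omega> i) = sv_supp n \<omega>"
  by (simp add: sv_supp_def)

lemma sv_BAR_uminus: "sv_BAR n (\<lambda>i. - \<omega> i) = sv_BAR n \<omega>"
  by (simp add: sv_BAR_def)

lemma sv_var_uminus: "sv_var n (\<lambda>i. - \<omega> i) = sv_var n \<omega>"
proof -
  have "filter (\<lambda>a. a \<noteq> 0) (map (\<lambda>i. - \<omega> i) ys) =
        map uminus (filter (\<lambda>a. a \<noteq> 0) (map \<omega> ys))" for ys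
    by (induction ys) auto
  then show ?thesis
    unfolding sv_var_def Let_def
    by (intro arg_cong[where f = card] Collect_cong) auto
qed

definition supp :: "nat \<Rightarrow> sign_vector set \<Rightarrow> int set" where
  "supp n x = (\<Union>\<omega>\<in>x. sv_supp n \<omega>)"

definition BAR :: "nat \<Rightarrow> sign_vector set \<Rightarrow> int set" where
  "BAR n x = (\<Union>\<omega>\<in>x. sv_BAR n \<omega>)"

definition wt :: "nat \<Rightarrow> sign_vector set \<Rightarrow> nat" where
  "wt n x = card (supp n x)"

definition sign_poset :: "nat \<Rightarrow> nat \<Rightarrow> sign_vector set set" where
  "sign_poset n m = {x \<in> PV n. \<forall>\<omega>\<in>x. sv_var n \<omega> \<le> m}"

definition sv_less :: "sign_vector set \<Rightarrow> sign_vector set \<Rightarrow> bool" where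
  "sv_less x y \<longleftrightarrow> (\<exists>\<omega>'\<in>x. \<exists>\<omega>\<in>y. sv_zeroing \<omega>' \<omega>)"

definition order_complex :: "nat \<Rightarrow> nat \<Rightarrow> sign_vector set set set" where
  "order_complex n m = {C. pred_on.chain (sign_poset n m) sv_less C}"


section \<open>Signed permutations\<close>

text \<open>
  A signed permutation is a function on all integers that is the identity outside
  \<open>{\<plusminus>1, \<dots>, \<plusminus>n}\<close>.
\<close>

definition signed_perms :: "nat \<Rightarrow> (int \<Rightarrow> int) set" where
  "signed_perms n = {\<pi>. \<pi> permutes ({- int n..int n} - {0}) \<and> (\<forall>i. \<pi> (- i) = - \<pi> i)}"

definition of_window :: "int list \<Rightarrow> int \<Rightarrow> int" where
  "of_window w i =
     (if 1 \<le> i \<and> i \<le> int (length w) then w ! (nat i - 1)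
      else if - int (length w) \<le> i \<and> i \<le> - 1 then - (w ! (nat (- i) - 1))
      else i)"

lemma map_of_window: "map (of_window w) [1..int (length w)] = w"
  by (rule nth_equalityI) (auto simp: of_window_def nat_add_distrib)

lemma of_window_signed_perm:
  assumes "abs ` set w = {1..int (length w)}"
  shows "of_window w \<in> signed_perms (length w)"
proof -
  define n where "n = length w"
  let ?S = "{- int n..int n} - {0}"
  let ?f = "of_window w"
  have odd: "?f (- i) = - ?f i" for i
    by (auto simp: of_window_def)
  have pos: "?f i = w ! (nat i - 1)" if "i \<in> {1..int n}" for i
    using that by (auto simp: of_window_def n_def)
  have range: "\<bar>?f i\<bar> \<in> {1..int n}" if "i \<in> {1..int n}" for i
  proof -
    have "?f i \<in> set w" using that pos by (auto simp: n_def)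
    then show ?thesis using assms by (auto simp: n_def)
  qed
  have into: "?f i \<in> ?S" if "i \<in> ?S" for i
  proof (cases "i > 0")
    case True
    then show ?thesis using range[of i] that by auto
  next
    case False
    then show ?thesis using range[of "- i"] odd[of i] that by auto
  qed
  have onto: "y \<in> ?f ` ?S" if "y \<in> ?S" for y
  proof -
    have "\<bar>y\<bar> \<in> abs ` set w" using that assms by (auto simp: n_def)
    then obtain k where k: "k < n" "\<bar>y\<bar> = \<bar>w ! k\<bar>"
      by (auto simp: in_set_conv_nth n_def)
    have f: "?f (int k + 1) = w ! k" using k by (simp add: of_window_def n_def nat_add_distrib)
    have "y = w ! k \<or> y = - (w ! k)" using k by linarith
    then show ?thesis
    proof
      assume "y = w ! k"
      then show ?thesis using f k by (intro image_eqI[of _ _ "int k + 1"]) auto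
    next
      assume "y = - (w ! k)"
      then show ?thesis using f k odd[of "int k + 1"]
        by (intro image_eqI[of _ _ "- (int k + 1)"]) auto
    qed
  qed
  have img: "?f ` ?S = ?S"
  proof
    show "?f ` ?S \<subseteq> ?S" by (rule image_subsetI) (rule into)
    show "?S \<subseteq> ?f ` ?S" by (rule subsetI) (rule onto)
  qed
  have "finite ?S" by simp
  then have "inj_on ?f ?S" by (rule eq_card_imp_inj_on) (simp only: img)
  then have "bij_betw ?f ?S ?S" unfolding bij_betw_def using img by (rule conjI)
  then have "?f permutes ?S"
    by (rule bij_imp_permutes) (auto simp: of_window_def n_def)
  then show ?thesis using odd by (simp add: signed_perms_def n_def)
qed

definition Des :: "nat \<Rightarrow> (int \<Rightarrow> int) \<Rightarrow> nat set" where
  "Des n \<pi> = (let w = (\<lambda>i. if i = 0 then 0 else \<pi> (int i)) in {i \<in> {0..<n}. w i > w (i + 1)})"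

definition des :: "nat \<Rightarrow> (int \<Rightarrow> int) \<Rightarrow> nat" where
  "des n \<pi> = card (Des n \<pi>)"


section \<open>The map from chains to signed permutations\<close>

definition chain_list :: "sign_vector set set \<Rightarrow> sign_vector set list" where
  "chain_list C = (THE xs. set xs = C \<and> sorted_wrt sv_less xs)"

definition chain_elem :: "sign_vector set set \<Rightarrow> nat \<Rightarrow> sign_vector set" where
  "chain_elem C s = (if s = 0 then {zero_sv} else chain_list C ! (s - 1))"

text \<open>
  With \<open>r = card C\<close>, \<open>block n C s\<close> is $I_s$ and \<open>signed_block n C s\<close> is $\bar{I}_s$,
  for \<open>1 \<le> s \<le> r + 1\<close>.
\<close>

definition block :: "nat \<Rightarrow> sign_vector set set \<Rightarrow> nat \<Rightarrow> int set" where
  "block n C s =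
     (if s = card C + 1 then {1..int n} - supp n (chain_elem C (card C))
      else supp n (chain_elem C s) - supp n (chain_elem C (s - 1)))"

definition signed_block :: "nat \<Rightarrow> sign_vector set set \<Rightarrow> nat \<Rightarrow> int set" where
  "signed_block n C s =
     (let B = BAR n (chain_elem C (card C))
      in {i. i \<in> block n C s \<and> i \<notin> B} \<union> {- i | i. i \<in> block n C s \<and> i \<in> B})"

definition Phi :: "nat \<Rightarrow> sign_vector set set \<Rightarrow> int \<Rightarrow> int" where
  "Phi n C =
     of_window (concat (map (\<lambda>s. sorted_list_of_set (signed_block n C s)) (rev [1..<card C + 2])))"


section \<open>The chains attached to an evenly signed permutation\<close>

text \<open>
  A class in \<open>PV n\<close> without zero entries always has an even number of cyclic sign flips. Hence
  the following definitions are meaningful only for signed permutations with an even number of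
  negative window entries.
\<close>

definition theta :: "nat \<Rightarrow> (int \<Rightarrow> int) \<Rightarrow> sign_vector set" where
  "theta n \<pi> =
     (THE x. x \<in> PV n \<and> supp n x = {1..int n} \<and>
             BAR n x = {\<bar>\<pi> i\<bar> | i. i \<in> {1..int n} \<and> \<pi> i < 0})"

definition restrict_class :: "int set \<Rightarrow> sign_vector set \<Rightarrow> sign_vector set" where
  "restrict_class S x = (\<lambda>\<omega> i. if i \<in> S then \<omega> i else 0) ` x"

definition upper_elem :: "nat \<Rightarrow> (int \<Rightarrow> int) \<Rightarrow> nat \<Rightarrow> sign_vector set" where
  "upper_elem n \<pi> j =
     restrict_class ((\<lambda>k. \<bar>\<pi> k\<bar>) ` {int n - int j + 1..int n}) (theta n \<pi>)"

text \<open>\<open>upper_chain n \<pi>\<close> is $C^\pi$ and \<open>lower_chain n \<pi>\<close> is $C_\pi$.\<close>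

definition upper_chain :: "nat \<Rightarrow> (int \<Rightarrow> int) \<Rightarrow> sign_vector set set" where
  "upper_chain n \<pi> = upper_elem n \<pi> ` {1..n}"

definition lower_chain :: "nat \<Rightarrow> (int \<Rightarrow> int) \<Rightarrow> sign_vector set set" where
  "lower_chain n \<pi> = {x \<in> upper_chain n \<pi>. wt n x \<in> (\<lambda>i. n - i) ` Des n \<pi>}"

end

theory Submission
  imports Defs "HOL-Library.Sublist"
begin

text \<open>
  Filling the zero entries of the top element \<open>\<omega>\<close> of a chain \<open>C\<close> with the cyclically preceding
  nonzero entry gives a vector \<open>\<theta>\<close> without zeros that has the same cyclic sign flips, and conversely
  zeroing entries that are not cyclic sign flips preserves the set of flips. The number of cyclic
  flips is \<open>var\<close> rounded up to an even number, so for even \<open>m\<close> the bound \<open>var \<le> m\<close> passes from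
  \<open>\<omega>\<close> to \<open>\<theta>\<close>.

  Call the number of elements of \<open>C\<close> whose support contains \<open>\<bar>a\<bar>\<close> the level of the letter \<open>a\<close>. The
  window of \<open>\<Phi>(C)\<close> lists the letters \<open>\<plusminus>i\<close>, negative exactly at the cyclic flips of \<open>\<theta>\<close>,
  lexicographically by level and value. A window is sorted in this way if and only if the supports of
  \<open>C\<close> are sets of final letters and every descent occurs where the level jumps; the first condition
  is \<open>C \<subseteq> C\<^sup>\<pi>\<close>, the second \<open>C\<^sub>\<pi> \<subseteq> C\<close>. Hence \<open>C\<close> lies in the interval of \<open>\<pi>\<close> if and only if
  \<open>\<Phi>(C) = \<pi>\<close>.
\<close>

section \<open>Sign changes and cyclic sign flips\<close>

definition sign_changes :: "int list \<Rightarrow> nat" where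
  "sign_changes xs = card {k. Suc k < length xs \<and> xs ! k * xs ! Suc k < 0}"

lemma sign_changes_Nil [simp]: "sign_changes [] = 0"
  by (simp add: sign_changes_def)

lemma sign_changes_single [simp]: "sign_changes [x] = 0"
  by (simp add: sign_changes_def)

lemma sign_changes_Cons:
  "sign_changes (x # y # ys) = (if x * y < 0 then 1 else 0) + sign_changes (y # ys)"
proof -
  let ?A = "{k. Suc k < length (y # ys) \<and> (y # ys) ! k * (y # ys) ! Suc k < 0}"
  have "{k. Suc k < length (x # y # ys) \<and> (x # y # ys) ! k * (x # y # ys) ! Suc k < 0} =
        (if x * y < 0 then {0} else {}) \<union> Suc ` ?A" (is "?L = ?R")
  proof (rule set_eqI)
    fix k show "k \<in> ?L \<longleftrightarrow> k \<in> ?R" by (cases k) auto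
  qed
  moreover have "finite ?A" by (rule finite_subset[of _ "{..length (y # ys)}"]) auto
  then have "card ((if x * y < 0 then {0} else {}) \<union> Suc ` ?A) =
        card (if x * y < 0 then {0::nat} else {}) + card (Suc ` ?A)"
    by (intro card_Un_disjoint) auto
  moreover have "card (Suc ` ?A) = card ?A" by (intro card_image) auto
  ultimately show ?thesis by (simp add: sign_changes_def)
qed

lemma sign_changes_snoc:
  "sign_changes (xs @ [x, y]) = sign_changes (xs @ [x]) + (if x * y < 0 then 1 else 0)"
proof (induction xs)
  case (Cons a xs)
  then show ?case by (cases xs) (auto simp: sign_changes_Cons)
qed (simp add: sign_changes_Cons)

lemma sign_changes_less_length: "xs \<noteq> [] \<Longrightarrow> sign_changes xs < length xs"
  by (induction xs rule: induct_list012) (auto simp: sign_changes_Cons)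

lemma sign_changes_Cons_le: "sign_changes (x # xs) \<le> Suc (sign_changes xs)"
  by (cases xs) (auto simp: sign_changes_Cons)

lemma sign_changes_le_Cons: "sign_changes xs \<le> sign_changes (x # xs)"
  by (cases xs) (auto simp: sign_changes_Cons)

text \<open>Over {-1, 1} each change flips the current sign, so the parity of the count tells
  whether the list ends with the sign it starts with. A list closed up to a cycle thus has an even
  count.\<close>

lemma even_sign_changes_iff:
  assumes "set (x # xs) \<subseteq> {-1, 1}"
  shows "even (sign_changes (x # xs)) \<longleftrightarrow> last (x # xs) = x"
  using assms
proof (induction xs arbitrary: x)
  case (Cons y ys)
  then show ?case using Cons.IH[of y] last_in_set[of "y # ys"]
    by (auto simp: sign_changes_Cons simp del: last_in_set)
qed simp

text \<open>The common head \<open>x\<close> carries the induction: an extra entry of the longer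
  list becomes the head to which the induction hypothesis is applied.\<close>

lemma sign_changes_Cons_subseq:
  assumes "subseq ys xs" "set xs \<subseteq> {-1, 1}" "x \<in> {-1, 1}"
  shows "sign_changes (x # ys) \<le> sign_changes (x # xs)"
  using assms
proof (induction arbitrary: x)
  case (list_emb_Nil ys)
  then show ?case by simp
next
  case (list_emb_Cons xs ys y)
  have "sign_changes (y # xs) \<le> sign_changes (y # ys)" if "y \<in> {-1, 1}"
    by (rule list_emb_Cons.IH) (use list_emb_Cons.prems that in auto)
  \<comment> \<open>Here \<open>xs\<close> is the shorter list. Triangle inequality: a change from
    \<open>x\<close> to the head of \<open>xs\<close> forces a change from \<open>x\<close> to
    \<open>y\<close> or from \<open>y\<close> to that head.\<close>
  then have "sign_changes (x # xs) \<le> (if x * y < 0 then 1 else 0) + sign_changes (y # xs)"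
    using list_emb_Cons.prems by (cases xs) (auto simp: sign_changes_Cons)
  then show ?case using list_emb_Cons by (fastforce simp: sign_changes_Cons)
next
  case (list_emb_Cons2 x' y xs ys)
  then show ?case by (auto simp: sign_changes_Cons)
qed

lemma sign_changes_subseq:
  assumes "subseq ys xs" "set xs \<subseteq> {-1, 1}"
  shows "sign_changes ys \<le> sign_changes xs"
  using assms
proof (induction)
  case (list_emb_Cons xs ys y)
  then show ?case using sign_changes_le_Cons[of ys y] by auto
next
  case (list_emb_Cons2 x y xs ys)
  then show ?case using sign_changes_Cons_subseq[of xs ys y] by auto
qed simp

section \<open>Sign changes of sign vectors and of their restrictions\<close>

abbreviation sv_entries :: "sign_vector \<Rightarrow> int list \<Rightarrow> int list" where
  "sv_entries \<omega> is \<equiv> filter (\<lambda>a. a \<noteq> 0) (map \<omega> is)"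

lemma sv_var_eq: "sv_var n \<omega> = sign_changes (sv_entries \<omega> [1..int n])"
  by (simp add: sv_var_def sign_changes_def Let_def)

definition sv_restrict :: "int set \<Rightarrow> sign_vector \<Rightarrow> sign_vector" where
  "sv_restrict S \<omega> = (\<lambda>i. if i \<in> S then \<omega> i else 0)"

lemma sv_restrict_in_sign_vectors:
  "\<omega> \<in> sign_vectors n \<Longrightarrow> sv_restrict S \<omega> \<in> sign_vectors n"
  by (auto simp: sign_vectors_def sv_restrict_def)

lemma set_sv_entries: "\<omega> \<in> sign_vectors n \<Longrightarrow> set (sv_entries \<omega> is) \<subseteq> {-1, 1}"
  by (auto simp: sign_vectors_def)

lemma sv_var_restrict_le:
  assumes "\<omega> \<in> sign_vectors n"
  shows "sv_var n (sv_restrict S \<omega>) \<le> sv_var n \<omega>"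
proof -
  have "subseq (sv_entries (sv_restrict S \<omega>) is) (sv_entries \<omega> is)" for "is"
    by (induction "is") (auto simp: sv_restrict_def)
  then show ?thesis
    unfolding sv_var_eq by (rule sign_changes_subseq) (rule set_sv_entries[OF assms])
qed

text \<open>For m = n - 1 this makes the bound on \<open>sv_var\<close> automatic, which settles
  that case without any parity argument.\<close>

lemma sv_var_le:
  assumes "n \<ge> 1" shows "sv_var n \<omega> \<le> n - 1"
proof (cases "sv_entries \<omega> [1..int n] = []")
  case True
  then show ?thesis unfolding sv_var_eq by (metis sign_changes_Nil le0)
next
  case False
  have "length (sv_entries \<omega> [1..int n]) \<le> n"
    using length_filter_le[of "\<lambda>a. a \<noteq> 0" "map \<omega> [1..int n]"] by simp
  with sign_changes_less_length[OF False] show ?thesis unfolding sv_var_eq by simp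
qed

section \<open>Cyclic filling of the zero entries\<close>

definition cyclic_fill :: "nat \<Rightarrow> sign_vector \<Rightarrow> sign_vector \<Rightarrow> bool" where
  "cyclic_fill n \<omega> \<theta> \<longleftrightarrow> \<theta> \<in> sign_vectors n \<and> (\<forall>i\<in>{1..int n}. \<theta> i \<noteq> 0 \<and>
     \<theta> i = (if \<omega> i = 0 then \<theta> (cyc_index n (i - 1)) else \<omega> i))"

lemma cyc_index_in: "n \<ge> 1 \<Longrightarrow> cyc_index n i \<in> {1..int n}"
  using pos_mod_bound[of "int n" "i - 1"] pos_mod_sign[of "int n" "i - 1"]
  unfolding cyc_index_def atLeastAtMost_iff by linarith

lemma cyc_index_diff: "cyc_index n (cyc_index n i - j) = cyc_index n (i - j)"
  by (simp add: cyc_index_def mod_diff_left_eq algebra_simps)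

lemma cyc_index_pred: "n \<ge> 1 \<Longrightarrow> i \<in> {1..int n} \<Longrightarrow> cyc_index n (i - 1) = (if i = 1 then int n else i - 1)"
  by (auto simp: cyc_index_def zmod_minus1 mod_pos_pos_trivial)

lemma cyclic_fill_self:
  "\<theta> \<in> sign_vectors n \<Longrightarrow> \<forall>i\<in>{1..int n}. \<theta> i \<noteq> 0 \<Longrightarrow> cyclic_fill n \<theta> \<theta>"
  by (simp add: cyclic_fill_def)

text \<open>Filling carries the nearest nonzero entry before \<open>i\<close> up to the cyclic
  predecessor of \<open>i\<close>, so the search in the definition of \<open>sv_BAR\<close> becomes
  a test at one neighbour.\<close>

lemma mem_BAR_cyclic_fill:
  assumes "n \<ge> 1" and fill: "cyclic_fill n \<omega> \<theta>" and i: "i \<in> {1..int n}"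
  shows "i \<in> sv_BAR n \<omega> \<longleftrightarrow> \<theta> (cyc_index n (i - 1)) * \<omega> i < 0"
proof (cases "\<omega> i = 0")
  case True
  then show ?thesis by (simp add: sv_BAR_def)
next
  case False
  have step: "\<theta> (cyc_index n (i - 1)) = \<theta> (cyc_index n (i - 1 - int k))"
    if "\<forall>l. 1 \<le> l \<and> l < 1 + int k \<longrightarrow> \<omega> (cyc_index n (i - l)) = 0" for k
    using that
  proof (induction k)
    case (Suc k)
    have "\<omega> (cyc_index n (i - 1 - int k)) = 0"
      using Suc.prems[rule_format, of "1 + int k"] by (simp add: algebra_simps)
    then have "\<theta> (cyc_index n (i - 1 - int k)) = \<theta> (cyc_index n (i - 1 - int k - 1))"
      using fill cyc_index_in[OF \<open>n \<ge> 1\<close>] cyc_index_diff unfolding cyclic_fill_def by metis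
    with Suc show ?case by (simp add: algebra_simps)
  qed simp
  have agree: "\<theta> (cyc_index n k) = \<omega> (cyc_index n k)" if "\<omega> (cyc_index n k) \<noteq> 0" for k
    using fill cyc_index_in[OF \<open>n \<ge> 1\<close>] that unfolding cyclic_fill_def by metis
  have first: "\<theta> (cyc_index n (i - 1)) = \<omega> (cyc_index n (i - j))"
    if "j \<ge> 1" "\<omega> (cyc_index n (i - j)) \<noteq> 0"
      "\<forall>k. 1 \<le> k \<and> k < j \<longrightarrow> \<omega> (cyc_index n (i - k)) = 0" for j
    using step[of "nat (j - 1)"] agree[of "i - j"] that by auto
  show ?thesis
  proof
    assume "i \<in> sv_BAR n \<omega>"
    then obtain j where "j \<ge> 1" "\<omega> (cyc_index n (i - j)) * \<omega> i < 0"
        "\<forall>k. 1 \<le> k \<and> k < j \<longrightarrow> \<omega> (cyc_index n (i - k)) = 0"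
      using False by (auto simp: sv_BAR_def)
    then show "\<theta> (cyc_index n (i - 1)) * \<omega> i < 0"
      using first[of j] by force
  next
    assume neg: "\<theta> (cyc_index n (i - 1)) * \<omega> i < 0"
    define P where "P = (\<lambda>k::nat. k \<ge> 1 \<and> \<omega> (cyc_index n (i - int k)) \<noteq> 0)"
    \<comment> \<open>After n steps back the search is at \<open>i\<close> again, where \<omega> is
      nonzero; hence a nearest nonzero entry exists.\<close>
    have "(i - 1 - int n) mod int n = i - 1" using i by simp
    then have "cyc_index n (i - int n) = i" by (simp add: cyc_index_def algebra_simps)
    then have "P n" using False \<open>n \<ge> 1\<close> by (simp add: P_def)
    then obtain k where k: "P k" "\<And>l. l < k \<Longrightarrow> \<not> P l"
      using LeastI[of P n] not_less_Least by metis
    have none: "\<omega> (cyc_index n (i - l)) = 0" if "1 \<le> l" "l < int k" for l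
      using k(2)[of "nat l"] that by (auto simp: P_def)
    have "\<theta> (cyc_index n (i - 1)) = \<omega> (cyc_index n (i - int k))"
      by (rule first) (use k(1) none in \<open>auto simp: P_def\<close>)
    then show "i \<in> sv_BAR n \<omega>"
      using i neg none k(1) unfolding sv_BAR_def
      by (auto simp: P_def intro!: exI[of _ "int k"])
  qed
qed

lemma BAR_subset: "sv_BAR n \<omega> \<subseteq> {1..int n}"
  by (auto simp: sv_BAR_def)

text \<open>A filled position repeats its predecessor and is no flip of \<theta>; at the other
  positions \<theta> and \<omega> agree and undergo the same test.\<close>

lemma BAR_cyclic_fill:
  assumes "n \<ge> 1" and fill: "cyclic_fill n \<omega> \<theta>"
  shows "sv_BAR n \<theta> = sv_BAR n \<omega>"
proof -
  have self: "cyclic_fill n \<theta> \<theta>" using fill by (auto simp: cyclic_fill_def)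
  have "i \<in> sv_BAR n \<theta> \<longleftrightarrow> i \<in> sv_BAR n \<omega>" if i: "i \<in> {1..int n}" for i
  proof -
    have "\<theta> i = (if \<omega> i = 0 then \<theta> (cyc_index n (i - 1)) else \<omega> i)"
      using fill i by (simp add: cyclic_fill_def)
    then show ?thesis
      using mem_BAR_cyclic_fill[OF \<open>n \<ge> 1\<close> fill i] mem_BAR_cyclic_fill[OF \<open>n \<ge> 1\<close> self i]
      by (auto simp: mult_less_0_iff split: if_splits)
  qed
  then show ?thesis using BAR_subset by blast
qed

text \<open>An entry of \<theta> that is no flip equals its predecessor, so filling recovers it
  after it has been erased. With \<open>BAR_cyclic_fill\<close> it follows that the restriction
  keeps the flips.\<close>

lemma cyclic_fill_restrict:
  assumes "n \<ge> 1" and \<theta>: "\<theta> \<in> sign_vectors n" "\<forall>i\<in>{1..int n}. \<theta> i \<noteq> 0" and "sv_BAR n \<theta> \<subseteq> S"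
  shows "cyclic_fill n (sv_restrict S \<theta>) \<theta>"
  unfolding cyclic_fill_def
proof (intro conjI ballI \<theta>(1))
  fix i assume i: "i \<in> {1..int n}"
  show "\<theta> i \<noteq> 0" using \<theta>(2) i by blast
  show "\<theta> i = (if sv_restrict S \<theta> i = 0 then \<theta> (cyc_index n (i - 1)) else sv_restrict S \<theta> i)"
  proof (cases "i \<in> S")
    case False
    then have "\<not> \<theta> (cyc_index n (i - 1)) * \<theta> i < 0"
      using mem_BAR_cyclic_fill[OF \<open>n \<ge> 1\<close> cyclic_fill_self[OF \<theta>] i] assms by auto
    moreover have "\<theta> j \<in> {-1, 1}" if "j \<in> {1..int n}" for j
      using \<theta> that by (auto simp: sign_vectors_def)
    then have "\<theta> (cyc_index n (i - 1)) \<in> {-1, 1}" "\<theta> i \<in> {-1, 1}"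
      using i cyc_index_in[OF \<open>n \<ge> 1\<close>] by blast+
    ultimately show ?thesis using False by (auto simp: sv_restrict_def)
  qed (use \<theta> i in \<open>auto simp: sv_restrict_def\<close>)
qed

text \<open>\<open>cyclic_fill\<close> is a relation since the zero vector, which stands for the
  empty chain, has two fillings, both constant; the construction picks one of them.\<close>

lemma cyclic_fill_exists:
  assumes "n \<ge> 1" and \<omega>: "\<omega> \<in> sign_vectors n"
  obtains \<theta> where "cyclic_fill n \<omega> \<theta>"
proof -
  \<comment> \<open>The last nonzero entry, or 1 if there is none, is the value that wraps around
    from position n to position 1. It starts the sequence \<open>g\<close>, whose value at k is the
    entry after filling at position k.\<close>
  define e where "e = last (1 # sv_entries \<omega> [1..int n])"
  define g where "g k = last (e # sv_entries \<omega> [1..int k])" for k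
  define \<theta> where "\<theta> i = (if i \<in> {1..int n} then g (nat i) else 0)" for i
  have pm: "last (x # sv_entries \<omega> is) \<in> {-1, 1}" if "x \<in> {-1, 1}" for x "is"
  proof -
    have "last (x # sv_entries \<omega> is) \<in> set (x # sv_entries \<omega> is)" by (rule last_in_set) simp
    then show ?thesis using set_sv_entries[OF \<omega>, of "is"] that by auto
  qed
  have e: "e \<in> {-1, 1}" unfolding e_def by (rule pm) simp
  have g: "g k \<in> {-1, 1}" for k unfolding g_def by (rule pm) (rule e)
  have g0: "g 0 = e" by (simp add: g_def)
  have gn: "g n = e" by (simp add: g_def e_def)
  have gSuc: "g (Suc k) = (if \<omega> (int k + 1) = 0 then g k else \<omega> (int k + 1))" for k
  proof -
    have "[1..int (Suc k)] = [1..int k] @ [int k + 1]"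
      using upto_rec2[of 1 "int k + 1"] by (simp add: add.commute)
    then show ?thesis by (simp add: g_def)
  qed
  have "cyclic_fill n \<omega> \<theta>"
    unfolding cyclic_fill_def
  proof (intro conjI ballI)
    show "\<theta> \<in> sign_vectors n"
      using g by (auto simp: sign_vectors_def \<theta>_def)
    fix i assume i: "i \<in> {1..int n}"
    show "\<theta> i \<noteq> 0" using g[of "nat i"] i by (auto simp: \<theta>_def)
    obtain k where k: "i = int k + 1" using i by (metis add.commute atLeastAtMost_iff zle_iff_zadd)
    have "\<theta> (cyc_index n (i - 1)) = g k"
      using k i g0 gn cyc_index_pred[OF assms(1) i] by (auto simp: \<theta>_def)
    moreover have "\<theta> i = g (Suc k)" using k i by (simp add: \<theta>_def nat_add_distrib)
    ultimately show "\<theta> i = (if \<omega> i = 0 then \<theta> (cyc_index n (i - 1)) else \<omega> i)"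
      using gSuc[of k] k by simp
  qed
  then show ?thesis by (rule that)
qed

text \<open>With the last entry of the filled vector put in front, the number of sign changes is even
  and does not change under filling.\<close>

lemma sv_var_cyclic_fill_le:
  assumes "n \<ge> 1" and \<omega>: "\<omega> \<in> sign_vectors n" and fill: "cyclic_fill n \<omega> \<theta>"
    and "even m" "sv_var n \<omega> \<le> m"
  shows "sv_var n \<theta> \<le> m"
proof -
  let ?e = "\<theta> (int n)"
  have pm: "\<theta> i \<in> {-1, 1}" if "i \<in> {1..int n}" for i
    using fill that unfolding cyclic_fill_def sign_vectors_def by blast
  \<comment> \<open>A filled position repeats the current last entry and so adds no change; at any
    other position both lists grow by the same entry.\<close>
  have same: "sign_changes (?e # sv_entries \<omega> [1..int k]) = sign_changes (?e # map \<theta> [1..int k]) \<and>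
       last (?e # sv_entries \<omega> [1..int k]) = last (?e # map \<theta> [1..int k])"
    if "k \<le> n" for k
    using that
  proof (induction k)
    case (Suc k)
    define xs where "xs = ?e # sv_entries \<omega> [1..int k]"
    define ys where "ys = ?e # map \<theta> [1..int k]"
    have IH: "sign_changes xs = sign_changes ys" "last xs = last ys"
      using Suc by (simp_all add: xs_def ys_def)
    have up: "[1..int (Suc k)] = [1..int k] @ [int k + 1]"
      using upto_rec2[of 1 "int k + 1"] by (simp add: add.commute)
    have snoc: "sign_changes (zs @ [z]) = sign_changes zs + (if last zs * z < 0 then 1 else 0)"
      if "zs \<noteq> []" for zs z
      using sign_changes_snoc[of "butlast zs" "last zs" z] that
      by (metis append.assoc append_Cons append_Nil append_butlast_last_id)
    have i: "int k + 1 \<in> {1..int n}" using Suc.prems by auto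
    have last: "last ys = \<theta> (cyc_index n (int k))"
    proof (cases k)
      case 0
      have "cyc_index n 0 = int n" using cyc_index_pred[OF assms(1), of 1] assms(1) by auto
      then show ?thesis using 0 by (simp add: ys_def)
    next
      case (Suc l)
      have "cyc_index n (int k) = int k" using cyc_index_pred[OF assms(1) i] Suc by auto
      moreover have "last ys = \<theta> (int k)"
        using Suc upto_rec2[of 1 "int k"] by (simp add: ys_def)
      ultimately show ?thesis by simp
    qed
    have rec: "\<theta> (int k + 1) = (if \<omega> (int k + 1) = 0 then last ys else \<omega> (int k + 1))"
      using fill i last unfolding cyclic_fill_def by (metis add_diff_cancel_right')
    have ys': "?e # map \<theta> [1..int (Suc k)] = ys @ [\<theta> (int k + 1)]"
      unfolding up ys_def by simp
    have xs': "?e # sv_entries \<omega> [1..int (Suc k)] =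
        (if \<omega> (int k + 1) = 0 then xs else xs @ [\<omega> (int k + 1)])"
      unfolding up xs_def by simp
    have "xs \<noteq> []" "ys \<noteq> []" by (auto simp: xs_def ys_def)
    then show ?case unfolding ys' xs'
      using IH rec by (auto simp: snoc mult_less_0_iff)
  qed simp
  have "sv_entries \<theta> [1..int n] = map \<theta> [1..int n]"
    unfolding filter_id_conv using pm by fastforce
  then have "sv_var n \<theta> \<le> sign_changes (?e # map \<theta> [1..int n])"
    unfolding sv_var_eq using sign_changes_le_Cons by metis
  also have "\<dots> = sign_changes (?e # sv_entries \<omega> [1..int n])"
    using same[of n] by simp
  also have "\<dots> \<le> m"
  proof -
    have "last (?e # map \<theta> [1..int n]) = ?e"
      using \<open>n \<ge> 1\<close> upto_rec2[of 1 "int n"] by simp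
    then have last: "last (?e # sv_entries \<omega> [1..int n]) = ?e"
      using conjunct2[OF same[OF order.refl]] by (rule trans[rotated])
    have set: "set (?e # sv_entries \<omega> [1..int n]) \<subseteq> {-1, 1}"
      using set_sv_entries[OF \<omega>, of "[1..int n]"] pm[of "int n"] \<open>n \<ge> 1\<close> by simp
    have "even (sign_changes (?e # sv_entries \<omega> [1..int n]))"
      by (rule even_sign_changes_iff[THEN iffD2, OF set last])
    \<comment> \<open>Prefixing adds at most one change, and an even number that is at most
      \<open>Suc m\<close> is at most \<open>m\<close>, because \<open>Suc m\<close> is odd.\<close>
    moreover have "sign_changes (?e # sv_entries \<omega> [1..int n]) \<le> Suc m"
      using sign_changes_Cons_le[of ?e "sv_entries \<omega> [1..int n]"] assms(5) unfolding sv_var_eq by linarith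
    ultimately show ?thesis using \<open>even m\<close> by (metis even_Suc le_Suc_eq)
  qed
  finally show ?thesis .
qed

text \<open>The flips fix the product of any two neighbouring entries, so the first entry determines
  the rest; \<open>c\<close> compares the two first entries. This gives the uniqueness behind
  \<open>theta\<close>.\<close>

lemma sv_eq_if_BAR_eq:
  assumes "n \<ge> 1"
    and \<theta>: "\<theta> \<in> sign_vectors n" "\<forall>i\<in>{1..int n}. \<theta> i \<noteq> 0"
    and \<eta>: "\<eta> \<in> sign_vectors n" "\<forall>i\<in>{1..int n}. \<eta> i \<noteq> 0"
    and BAR: "sv_BAR n \<theta> = sv_BAR n \<eta>"
  shows "\<eta> = \<theta> \<or> \<eta> = (\<lambda>i. - \<theta> i)"
proof -
  define c where "c = \<eta> 1 * \<theta> 1"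
  have pm: "\<theta> i \<in> {-1, 1} \<and> \<eta> i \<in> {-1, 1}" if "i \<in> {1..int n}" for i
    using \<theta> \<eta> that unfolding sign_vectors_def by blast
  have eq: "\<eta> (int k + 1) = c * \<theta> (int k + 1)" if "k < n" for k
    using that
  proof (induction k)
    case 0
    then show ?case using pm[of 1] by (auto simp: c_def)
  next
    case (Suc k)
    let ?i = "int (Suc k) + 1"
    have i: "?i \<in> {1..int n}" and i': "int k + 1 \<in> {1..int n}" using Suc.prems by auto
    have pred: "cyc_index n (?i - 1) = int k + 1"
      using cyc_index_pred[OF \<open>n \<ge> 1\<close> i] by simp
    have "\<theta> (int k + 1) * \<theta> ?i < 0 \<longleftrightarrow> \<eta> (int k + 1) * \<eta> ?i < 0"
      using mem_BAR_cyclic_fill[OF \<open>n \<ge> 1\<close> cyclic_fill_self[OF \<theta>] i]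
        mem_BAR_cyclic_fill[OF \<open>n \<ge> 1\<close> cyclic_fill_self[OF \<eta>] i] BAR
      unfolding pred by simp
    moreover have "\<eta> (int k + 1) = c * \<theta> (int k + 1)" using Suc by simp
    moreover have "c \<in> {-1, 1}" using pm[of 1] \<open>n \<ge> 1\<close> by (auto simp: c_def)
    ultimately show ?case using pm[OF i] pm[OF i'] by auto
  qed
  have "\<eta> i = c * \<theta> i" for i
  proof (cases "i \<in> {1..int n}")
    case True
    then show ?thesis using eq[of "nat (i - 1)"] by auto
  next
    case False
    then show ?thesis using \<theta>(1) \<eta>(1) by (auto simp: sign_vectors_def)
  qed
  moreover have "c \<in> {-1, 1}" using pm[of 1] \<open>n \<ge> 1\<close> by (auto simp: c_def)
  ultimately show ?thesis by auto
qed


section \<open>Chains of sign vectors up to negation\<close>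

text \<open>Also applied to the zero vector, where it gives the value of \<open>chain_elem\<close>
  at 0, so that the empty chain needs little special treatment.\<close>

definition sv_class :: "sign_vector \<Rightarrow> sign_vector set" where
  "sv_class \<omega> = {\<omega>, \<lambda>i. - \<omega> i}"

lemma sv_class_zero: "sv_class zero_sv = {zero_sv}"
  by (auto simp: sv_class_def zero_sv_def)

lemma sv_class_uminus: "sv_class (\<lambda>i. - \<omega> i) = sv_class \<omega>"
  by (auto simp: sv_class_def)

lemma sv_uminus_in_sign_vectors: "\<omega> \<in> sign_vectors n \<Longrightarrow> (\<lambda>i. - \<omega> i) \<in> sign_vectors n"
  by (auto simp: sign_vectors_def)

lemma finite_sign_vectors: "finite (sign_vectors n)"
proof -
  have "finite {f. \<forall>x. (x \<in> {1..int n} \<longrightarrow> f x \<in> {-1, 0, 1::int}) \<and> (x \<notin> {1..int n} \<longrightarrow> f x = 0)}"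
    by (rule finite_set_of_finite_funs) simp_all
  then show ?thesis
    by (rule rev_finite_subset) (auto simp: sign_vectors_def)
qed

lemma PV_eq: "PV n = sv_class ` (sign_vectors n - {zero_sv})"
proof -
  have "neg_rel n `` {\<omega>} = sv_class \<omega>" if "\<omega> \<in> sign_vectors n - {zero_sv}" for \<omega>
    using that sv_uminus_in_sign_vectors[of \<omega> n]
    by (auto simp: neg_rel_def sv_class_def zero_sv_def fun_eq_iff)
  then show ?thesis by (auto simp: PV_def quotient_def)
qed

lemma finite_PV: "finite (PV n)"
  by (simp add: PV_eq finite_sign_vectors)

lemma supp_sv_class [simp]: "supp n (sv_class \<omega>) = sv_supp n \<omega>"
  by (simp add: supp_def sv_class_def sv_supp_uminus)

lemma BAR_sv_class [simp]: "BAR n (sv_class \<omega>) = sv_BAR n \<omega>"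
  by (simp add: BAR_def sv_class_def sv_BAR_uminus)

lemma sign_poset_eq:
  "sign_poset n m = sv_class ` {\<omega> \<in> sign_vectors n - {zero_sv}. sv_var n \<omega> \<le> m}"
  by (auto simp: sign_poset_def PV_eq) (auto simp: sv_class_def sv_var_uminus)

lemma sv_supp_restrict [simp]: "sv_supp n (sv_restrict S \<omega>) = S \<inter> sv_supp n \<omega>"
  by (auto simp: sv_supp_def sv_restrict_def)

lemma restrict_class_sv_class: "restrict_class S (sv_class \<omega>) = sv_class (sv_restrict S \<omega>)"
  by (auto simp: restrict_class_def sv_class_def sv_restrict_def fun_eq_iff)

lemma sv_restrict_restrict: "sv_restrict S (sv_restrict T \<omega>) = sv_restrict (S \<inter> T) \<omega>"
  by (auto simp: sv_restrict_def)

lemma sv_restrict_empty: "sv_restrict {} \<omega> = zero_sv"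
  by (auto simp: sv_restrict_def zero_sv_def)

lemma sv_restrict_supp:
  "\<omega> \<in> sign_vectors n \<Longrightarrow> sv_supp n \<omega> \<subseteq> S \<Longrightarrow> sv_restrict S \<omega> = \<omega>"
  by (auto simp: sv_restrict_def sv_supp_def sign_vectors_def fun_eq_iff)

lemma sv_supp_eq_empty_iff: "\<omega> \<in> sign_vectors n \<Longrightarrow> sv_supp n \<omega> = {} \<longleftrightarrow> \<omega> = zero_sv"
  by (auto simp: sv_supp_def sign_vectors_def zero_sv_def fun_eq_iff)

text \<open>Zeroing entries of a representative \<eta> leaves its restriction to a smaller support.
  As \<eta> is \<omega> or its negative, the class of the restriction is the same, and below a fixed
  class an element is determined by its support.\<close>

lemma sv_less_class_imp:
  assumes "x \<in> PV n" "\<omega> \<in> sign_vectors n" "sv_less x (sv_class \<omega>)"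
  shows "x = sv_class (sv_restrict (supp n x) \<omega>)" "supp n x \<subset> sv_supp n \<omega>"
proof -
  obtain \<alpha> \<eta> where \<alpha>: "\<alpha> \<in> x" and \<eta>: "\<eta> \<in> sv_class \<omega>" and zero: "sv_zeroing \<alpha> \<eta>"
    using assms(3) by (auto simp: sv_less_def)
  have x: "x = sv_class \<alpha>" and \<alpha>_sv: "\<alpha> \<in> sign_vectors n"
    using assms(1) \<alpha> by (auto simp: PV_eq sv_class_def sign_vectors_def)
  have \<eta>_sv: "\<eta> \<in> sign_vectors n"
    using \<eta> assms(2) by (auto simp: sv_class_def sv_uminus_in_sign_vectors)
  have class_\<eta>: "sv_class \<eta> = sv_class \<omega>"
    using \<eta> by (auto simp: sv_class_def)
  have \<alpha>_eq: "\<alpha> = sv_restrict (sv_supp n \<alpha>) \<eta>"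
  proof
    fix i
    have "\<alpha> i = \<eta> i \<or> \<alpha> i = 0" using zero unfolding sv_zeroing_def by blast
    moreover have "i \<notin> {1..int n} \<longrightarrow> \<alpha> i = 0" using \<alpha>_sv unfolding sign_vectors_def by blast
    ultimately show "\<alpha> i = sv_restrict (sv_supp n \<alpha>) \<eta> i"
      by (auto simp: sv_restrict_def sv_supp_def)
  qed
  then have "x = restrict_class (supp n x) (sv_class \<eta>)"
    unfolding restrict_class_sv_class using x by simp
  then show "x = sv_class (sv_restrict (supp n x) \<omega>)"
    unfolding class_\<eta> restrict_class_sv_class .
  have "sv_supp n \<alpha> \<subseteq> sv_supp n \<eta>"
  proof
    fix i assume "i \<in> sv_supp n \<alpha>"
    moreover have "\<alpha> i = \<eta> i \<or> \<alpha> i = 0" using zero unfolding sv_zeroing_def by blast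
    ultimately show "i \<in> sv_supp n \<eta>" by (auto simp: sv_supp_def)
  qed
  moreover have "sv_supp n \<alpha> \<noteq> sv_supp n \<eta>"
    using zero \<alpha>_eq sv_restrict_supp[OF \<eta>_sv order.refl] unfolding sv_zeroing_def by metis
  moreover have "sv_supp n \<eta> = sv_supp n \<omega>"
    using arg_cong[OF class_\<eta>, of "supp n"] by simp
  ultimately show "supp n x \<subset> sv_supp n \<omega>"
    using x by auto
qed

lemma sv_less_supp:
  assumes "x \<in> PV n" "y \<in> PV n" "sv_less x y"
  shows "supp n x \<subset> supp n y"
proof -
  obtain \<omega> where "\<omega> \<in> sign_vectors n" "y = sv_class \<omega>" using assms(2) by (auto simp: PV_eq)
  then show ?thesis using sv_less_class_imp(2)[OF assms(1)] assms(3) by simp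
qed

lemma supp_PV_subset: "x \<in> PV n \<Longrightarrow> supp n x \<subseteq> {1..int n}"
  by (auto simp: PV_eq sv_supp_def)

lemma finite_supp_PV: "x \<in> PV n \<Longrightarrow> finite (supp n x)"
  by (rule finite_subset[OF supp_PV_subset]) auto

lemma sv_less_restrictI:
  assumes "S \<subset> T" "T \<subseteq> sv_supp n \<omega>"
  shows "sv_less (sv_class (sv_restrict S \<omega>)) (sv_class (sv_restrict T \<omega>))"
proof -
  obtain i where "i \<in> T" "i \<notin> S" using assms(1) by blast
  then have "sv_restrict S \<omega> \<noteq> sv_restrict T \<omega>"
    using assms(2) by (auto simp: sv_restrict_def sv_supp_def fun_eq_iff)
  then have "sv_zeroing (sv_restrict S \<omega>) (sv_restrict T \<omega>)"
    using assms(1) by (auto simp: sv_zeroing_def sv_restrict_def)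
  then show ?thesis by (auto simp: sv_less_def sv_class_def)
qed

text \<open>If the heads were different, each would have to precede the other. This serves both
  \<open>chain_list\<close>, sorted by \<open>sv_less\<close>, and the window of \<open>Phi\<close>,
  sorted by \<open>chain_prec\<close>.\<close>

lemma sorted_wrt_set_unique:
  assumes "sorted_wrt R xs" "sorted_wrt R ys" "set xs = set ys"
    and "\<And>x y. x \<in> set xs \<Longrightarrow> y \<in> set xs \<Longrightarrow> R x y \<Longrightarrow> \<not> R y x"
  shows "xs = ys"
  using assms
proof (induction xs arbitrary: ys)
  case (Cons x xs)
  obtain y ys' where ys: "ys = y # ys'" using Cons.prems(3) by (cases ys) simp_all
  have irrefl: "\<not> R x x" using Cons.prems(4)[of x x] by auto
  have "x = y"
  proof (rule ccontr)
    assume "x \<noteq> y"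
    then have "x \<in> set ys'" "y \<in> set xs" using Cons.prems(3) ys by auto
    then have "R y x" "R x y" using Cons.prems(1,2) ys by auto
    then show False using Cons.prems(4)[of x y] \<open>y \<in> set xs\<close> by simp
  qed
  moreover have "x \<notin> set xs" "y \<notin> set ys'"
    using Cons.prems(1,2) irrefl ys \<open>x = y\<close> by auto
  ultimately have "set xs = set ys'" using Cons.prems(3) ys by auto
  moreover have "sorted_wrt R xs" "sorted_wrt R ys'" using Cons.prems(1,2) ys by auto
  ultimately have "xs = ys'"
    by (intro Cons.IH) (auto dest: Cons.prems(4)[rotated 2])
  then show ?case using ys \<open>x = y\<close> by simp
qed simp

lemma sorted_wrt_irrefl_distinct:
  assumes "sorted_wrt R xs" "\<And>x. x \<in> set xs \<Longrightarrow> \<not> R x x"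
  shows "distinct xs"
  using assms by (induction xs) auto

lemma sorted_wrt_concat_map:
  assumes "\<And>i. i \<in> set is \<Longrightarrow> sorted_wrt R (f i)"
    and "sorted_wrt (\<lambda>i j. \<forall>a\<in>set (f i). \<forall>b\<in>set (f j). R a b) is"
  shows "sorted_wrt R (concat (map f is))"
  using assms by (induction "is") (auto simp: sorted_wrt_append)

section \<open>Chains as sorted lists\<close>

abbreviation sv_chain :: "nat \<Rightarrow> sign_vector set set \<Rightarrow> bool" where
  "sv_chain n C \<equiv> pred_on.chain (PV n) sv_less C"

lemma sv_chain_iff:
  "sv_chain n C \<longleftrightarrow> C \<subseteq> PV n \<and> (\<forall>x\<in>C. \<forall>y\<in>C. sv_less x y \<or> x = y \<or> sv_less y x)"
  by (auto simp: pred_on.chain_def)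

lemma order_complex_iff:
  "C \<in> order_complex n m \<longleftrightarrow> sv_chain n C \<and> C \<subseteq> sign_poset n m"
  by (auto simp: order_complex_def pred_on.chain_def sign_poset_def)

lemma sv_chain_less_asym:
  "sv_chain n C \<Longrightarrow> x \<in> C \<Longrightarrow> y \<in> C \<Longrightarrow> sv_less x y \<Longrightarrow> \<not> sv_less y x"
  using sv_less_supp[of x n y] sv_less_supp[of y n x] by (auto simp: sv_chain_iff)

lemma sv_chain_supp_linear:
  assumes "sv_chain n C" "x \<in> C" "y \<in> C"
  shows "supp n x \<subseteq> supp n y \<or> supp n y \<subseteq> supp n x"
  using assms sv_less_supp unfolding sv_chain_iff by blast

lemma chain_list:
  assumes "sv_chain n C"
  shows "set (chain_list C) = C" "sorted_wrt sv_less (chain_list C)"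
proof -
  have "finite C" using assms finite_PV finite_subset unfolding sv_chain_iff by blast
  then obtain zs where zs: "set zs = C" "distinct zs" using finite_distinct_list by blast
  \<comment> \<open>Along \<open>sv_less\<close> the supports grow strictly, so sorting by their
    size produces the increasing list.\<close>
  define xs where "xs = sort_key (\<lambda>x. card (supp n x)) zs"
  have xs: "set xs = C" "distinct xs" "sorted (map (\<lambda>x. card (supp n x)) xs)"
    using zs by (auto simp: xs_def)
  have "sorted_wrt sv_less xs"
    unfolding sorted_wrt_iff_nth_less
  proof (intro allI impI)
    fix i j assume ij: "i < j" "j < length xs"
    have "xs ! i \<noteq> xs ! j" using ij xs(2) by (simp add: nth_eq_iff_index_eq)
    moreover have "card (supp n (xs ! i)) \<le> card (supp n (xs ! j))"
      using ij xs(3) by (auto simp: sorted_iff_nth_mono)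
    moreover have mem: "xs ! i \<in> C" "xs ! j \<in> C" using ij xs(1) by (auto simp: set_conv_nth)
    moreover have PV: "xs ! i \<in> PV n" "xs ! j \<in> PV n"
      using mem assms unfolding sv_chain_iff by auto
    moreover have "sv_less (xs ! i) (xs ! j) \<or> xs ! i = xs ! j \<or> sv_less (xs ! j) (xs ! i)"
      using mem assms unfolding sv_chain_iff by auto
    ultimately show "sv_less (xs ! i) (xs ! j)"
      using sv_less_supp[OF PV(2,1)] psubset_card_mono[OF finite_supp_PV[OF PV(1)], of "supp n (xs ! j)"]
      by auto
  qed
  moreover have "ys = xs" if ys: "set ys = C \<and> sorted_wrt sv_less ys" for ys
  proof (rule sorted_wrt_set_unique[OF conjunct2[OF ys] \<open>sorted_wrt sv_less xs\<close>])
    show "set ys = set xs" using ys xs(1) by blast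
    show "\<not> sv_less y x" if "x \<in> set ys" "y \<in> set ys" "sv_less x y" for x y
      using that ys sv_chain_less_asym[OF assms] by blast
  qed
  ultimately have "chain_list C = xs"
    unfolding chain_list_def using xs(1) by (intro the_equality) blast+
  then show "set (chain_list C) = C" "sorted_wrt sv_less (chain_list C)"
    using xs(1) \<open>sorted_wrt sv_less xs\<close> by auto
qed

lemma length_chain_list:
  assumes "sv_chain n C" shows "length (chain_list C) = card C"
proof -
  have "distinct (chain_list C)"
    using chain_list[OF assms]
    by (intro sorted_wrt_irrefl_distinct[of sv_less]) (auto dest: sv_chain_less_asym[OF assms])
  then show ?thesis using chain_list(1)[OF assms] distinct_card by metis
qed

lemma chain_elem_in:
  assumes "sv_chain n C" "1 \<le> s" "s \<le> card C" shows "chain_elem C s \<in> C"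
proof -
  have "chain_list C ! (s - 1) \<in> set (chain_list C)"
    by (rule nth_mem) (use assms length_chain_list in simp)
  then show ?thesis using assms chain_list(1)[OF assms(1)] by (simp add: chain_elem_def)
qed

lemma chain_elem_cases:
  assumes "sv_chain n C" "x \<in> C"
  obtains s where "1 \<le> s" "s \<le> card C" "x = chain_elem C s"
proof -
  obtain k where "k < card C" "x = chain_list C ! k"
    using assms chain_list(1)[OF assms(1)] length_chain_list[OF assms(1)]
    by (metis in_set_conv_nth)
  then show ?thesis by (intro that[of "Suc k"]) (auto simp: chain_elem_def)
qed

lemma supp_zero_class [simp]: "supp n {zero_sv} = {}"
  by (simp add: supp_def sv_supp_def zero_sv_def)

lemma supp_chain_elem_mono:
  assumes "sv_chain n C" "s \<le> t" "t \<le> card C"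
  shows "supp n (chain_elem C s) \<subseteq> supp n (chain_elem C t)"
proof (cases "s = 0 \<or> s = t")
  case True
  then show ?thesis by (auto simp: chain_elem_def)
next
  case False
  then have "sv_less (chain_list C ! (s - 1)) (chain_list C ! (t - 1))"
    using assms chain_list(2)[OF assms(1)] length_chain_list[OF assms(1)]
    by (auto simp: sorted_wrt_iff_nth_less)
  then have "sv_less (chain_elem C s) (chain_elem C t)"
    using False assms by (auto simp: chain_elem_def)
  moreover have "chain_elem C s \<in> PV n" "chain_elem C t \<in> PV n"
    using chain_elem_in[OF assms(1), of s] chain_elem_in[OF assms(1), of t] False assms
    unfolding sv_chain_iff by auto
  ultimately show ?thesis using sv_less_supp by blast
qed

abbreviation chain_top :: "sign_vector set set \<Rightarrow> sign_vector set" where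
  "chain_top C \<equiv> chain_elem C (card C)"

lemma chain_top_cases:
  assumes "sv_chain n C"
  obtains "C = {}" "chain_top C = {zero_sv}" | "chain_top C \<in> C"
proof -
  have "finite C" using assms finite_PV finite_subset unfolding sv_chain_iff by blast
  then show ?thesis
    using that chain_elem_in[OF assms, of "card C"]
    by (cases "card C = 0") (auto simp: chain_elem_def)
qed

lemma supp_subset_chain_top:
  assumes "sv_chain n C" "x \<in> C"
  shows "supp n x \<subseteq> supp n (chain_top C)"
  using assms by (metis chain_elem_cases order.refl supp_chain_elem_mono)

text \<open>All supports lie in that of the top, so every other element is below the top and
  \<open>sv_less_class_imp\<close> applies. One representative and the supports thus describe the
  whole chain.\<close>

lemma chain_eq_restrict_top:
  assumes C: "sv_chain n C" and "x \<in> C" "chain_top C = sv_class \<omega>" "\<omega> \<in> sign_vectors n"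
  shows "x = sv_class (sv_restrict (supp n x) \<omega>)"
proof -
  have top: "chain_top C \<in> C"
    using chain_top_cases[OF C] \<open>x \<in> C\<close> by auto
  show ?thesis
  proof (cases "x = chain_top C")
    case True
    then show ?thesis using assms sv_restrict_supp[of \<omega> n "sv_supp n \<omega>"] by simp
  next
    case False
    have "\<not> sv_less (chain_top C) x"
      using sv_less_supp[of "chain_top C" n x] supp_subset_chain_top[OF C \<open>x \<in> C\<close>] C top \<open>x \<in> C\<close>
      unfolding sv_chain_iff by blast
    then have "sv_less x (sv_class \<omega>)"
      using False C top assms(2,3) unfolding sv_chain_iff by metis
    moreover have "x \<in> PV n" using assms(1,2) unfolding sv_chain_iff by blast
    ultimately show ?thesis using sv_less_class_imp(1) assms(4) by blast
  qed
qed

section \<open>Levels of letters and the window of \<open>Phi\<close>\<close>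

definition chain_level :: "nat \<Rightarrow> sign_vector set set \<Rightarrow> int \<Rightarrow> nat" where
  "chain_level n C a = card {x \<in> C. \<bar>a\<bar> \<in> supp n x}"

definition chain_prec :: "nat \<Rightarrow> sign_vector set set \<Rightarrow> int \<Rightarrow> int \<Rightarrow> bool" where
  "chain_prec n C a b \<longleftrightarrow>
     chain_level n C a < chain_level n C b \<or> chain_level n C a = chain_level n C b \<and> a < b"

lemma chain_prec_asym: "chain_prec n C a b \<Longrightarrow> \<not> chain_prec n C b a"
  by (auto simp: chain_prec_def)

lemma transp_chain_prec: "transp (chain_prec n C)"
  by (auto simp: chain_prec_def transp_def)

text \<open>The supports are nested, so the sets of chain elements that contain two given letters
  are comparable by inclusion; comparing their sizes then amounts to finding an element that
  separates the letters.\<close>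

lemma chain_level_less_iff:
  assumes "sv_chain n C"
  shows "chain_level n C a < chain_level n C b \<longleftrightarrow> (\<exists>x\<in>C. \<bar>b\<bar> \<in> supp n x \<and> \<bar>a\<bar> \<notin> supp n x)"
proof
  have fin: "finite C" using assms finite_PV finite_subset unfolding sv_chain_iff by blast
  assume "chain_level n C a < chain_level n C b"
  then have "\<not> {x \<in> C. \<bar>b\<bar> \<in> supp n x} \<subseteq> {x \<in> C. \<bar>a\<bar> \<in> supp n x}"
    using fin card_mono[of "{x \<in> C. \<bar>a\<bar> \<in> supp n x}" "{x \<in> C. \<bar>b\<bar> \<in> supp n x}"]
    by (auto simp: chain_level_def)
  then show "\<exists>x\<in>C. \<bar>b\<bar> \<in> supp n x \<and> \<bar>a\<bar> \<notin> supp n x" by blast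
next
  have fin: "finite C" using assms finite_PV finite_subset unfolding sv_chain_iff by blast
  assume "\<exists>x\<in>C. \<bar>b\<bar> \<in> supp n x \<and> \<bar>a\<bar> \<notin> supp n x"
  then obtain x where x: "x \<in> C" "\<bar>b\<bar> \<in> supp n x" "\<bar>a\<bar> \<notin> supp n x" by blast
  then have "{x \<in> C. \<bar>a\<bar> \<in> supp n x} \<subset> {x \<in> C. \<bar>b\<bar> \<in> supp n x}"
    using sv_chain_supp_linear[OF assms] by blast
  then show "chain_level n C a < chain_level n C b"
    unfolding chain_level_def by (intro psubset_card_mono) (use fin in auto)
qed

definition signed_set :: "nat \<Rightarrow> int set \<Rightarrow> int set" where
  "signed_set n B = {i \<in> {1..int n}. i \<notin> B} \<union> {- i |i. i \<in> {1..int n} \<and> i \<in> B}"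

definition Phi_word :: "nat \<Rightarrow> sign_vector set set \<Rightarrow> int list" where
  "Phi_word n C = concat (map (\<lambda>s. sorted_list_of_set (signed_block n C s)) (rev [1..<card C + 2]))"

lemma Phi_eq: "Phi n C = of_window (Phi_word n C)"
  by (simp add: Phi_def Phi_word_def)

lemma block_eq:
  "block n C s = (if s = card C + 1 then {1..int n} else supp n (chain_elem C s)) - supp n (chain_elem C (s - 1))"
  by (simp add: block_def)

text \<open>A letter of block s enters the supports at the s-th element and stays. All letters of a
  block therefore have the same level, and a later block has a lower level.\<close>

lemma chain_level_block:
  assumes C: "sv_chain n C" and "1 \<le> s" "s \<le> card C + 1" "\<bar>a\<bar> \<in> block n C s" "t \<le> card C"
  shows "\<bar>a\<bar> \<in> supp n (chain_elem C t) \<longleftrightarrow> s \<le> t"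
proof (cases "s \<le> t")
  case True
  then have "\<bar>a\<bar> \<in> supp n (chain_elem C s)" using assms by (auto simp: block_eq)
  moreover have "supp n (chain_elem C s) \<subseteq> supp n (chain_elem C t)"
    by (rule supp_chain_elem_mono[OF C True assms(5)])
  ultimately show ?thesis using True by blast
next
  case False
  then have "supp n (chain_elem C t) \<subseteq> supp n (chain_elem C (s - 1))"
    using assms(3,5) by (intro supp_chain_elem_mono[OF C]) simp_all
  moreover have "\<bar>a\<bar> \<notin> supp n (chain_elem C (s - 1))" using assms(4) by (auto simp: block_eq)
  ultimately show ?thesis using False by blast
qed

lemma block_subset:
  assumes "sv_chain n C" "1 \<le> s" "s \<le> card C + 1"
  shows "block n C s \<subseteq> {1..int n}"
proof (cases "s = card C + 1")
  case False
  then have "chain_elem C s \<in> PV n"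
    using chain_elem_in[OF assms(1), of s] assms unfolding sv_chain_iff by auto
  then show ?thesis using supp_PV_subset False by (auto simp: block_eq)
qed (auto simp: block_eq)

lemma Union_block:
  assumes C: "sv_chain n C" and i: "i \<in> {1..int n}"
  obtains s where "1 \<le> s" "s \<le> card C + 1" "i \<in> block n C s"
proof -
  \<comment> \<open>The index \<open>card C + 1\<close> is a sentinel, so that the least index
    exists also for a position outside all supports.\<close>
  define P where "P s \<longleftrightarrow> s = card C + 1 \<or> i \<in> supp n (chain_elem C s)" for s
  have "P (card C + 1)" by (simp add: P_def)
  then obtain s where s: "P s" "\<And>t. t < s \<Longrightarrow> \<not> P t" "s \<le> card C + 1"
    using LeastI[of P] not_less_Least Least_le by metis
  have "\<not> P 0" by (simp add: P_def chain_elem_def)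
  then have "s \<ge> 1" using s(1) by (cases s) auto
  moreover have "\<not> P (s - 1)" using s(2)[of "s - 1"] \<open>s \<ge> 1\<close> by simp
  ultimately show ?thesis using s i by (intro that[of s]) (auto simp: P_def block_eq)
qed

lemma abs_signed_block:
  assumes "sv_chain n C" "1 \<le> s" "s \<le> card C + 1" "a \<in> signed_block n C s"
  shows "\<bar>a\<bar> \<in> block n C s"
  using block_subset[OF assms(1-3)] assms(4) by (fastforce simp: signed_block_def Let_def)

lemma finite_signed_block:
  assumes "sv_chain n C" "1 \<le> s" "s \<le> card C + 1" shows "finite (signed_block n C s)"
proof (rule finite_subset)
  show "signed_block n C s \<subseteq> {- int n..int n}"
    using block_subset[OF assms] by (fastforce simp: signed_block_def Let_def)
qed simp

text \<open>Inside a block the levels agree and the values increase. The blocks are listed from last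
  to first, hence with increasing level.\<close>

lemma sorted_Phi_word:
  assumes C: "sv_chain n C"
  shows "sorted_wrt (chain_prec n C) (Phi_word n C)"
  unfolding Phi_word_def
proof (rule sorted_wrt_concat_map)
  fix s assume "s \<in> set (rev [1..<card C + 2])"
  then have s: "1 \<le> s" "s \<le> card C + 1" by auto
  have "sorted_wrt (<) (sorted_list_of_set (signed_block n C s))"
    by (rule strict_sorted_list_of_set)
  then show "sorted_wrt (chain_prec n C) (sorted_list_of_set (signed_block n C s))"
  proof (rule sorted_wrt_mono_rel[rotated])
    fix a b assume ab: "a \<in> set (sorted_list_of_set (signed_block n C s))"
      "b \<in> set (sorted_list_of_set (signed_block n C s))" "a < b"
    then have "\<bar>a\<bar> \<in> block n C s" "\<bar>b\<bar> \<in> block n C s"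
      using finite_signed_block[OF C s] abs_signed_block[OF C s] by auto
    then have "{x \<in> C. \<bar>a\<bar> \<in> supp n x} = {x \<in> C. \<bar>b\<bar> \<in> supp n x}"
      using chain_level_block[OF C s] by (metis chain_elem_cases[OF C])
    then show "chain_prec n C a b" using ab(3) by (simp add: chain_prec_def chain_level_def)
  qed
next
  have "sorted_wrt (>) (rev [1..<card C + 2])"
    by (simp add: sorted_wrt_rev del: upt_Suc)
  then show "sorted_wrt (\<lambda>s t. \<forall>a\<in>set (sorted_list_of_set (signed_block n C s)).
      \<forall>b\<in>set (sorted_list_of_set (signed_block n C t)). chain_prec n C a b) (rev [1..<card C + 2])"
  proof (rule sorted_wrt_mono_rel[rotated], intro ballI)
    fix s t a b
    assume "s \<in> set (rev [1..<card C + 2])" "t \<in> set (rev [1..<card C + 2])" "t < s"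
      and ab: "a \<in> set (sorted_list_of_set (signed_block n C s))"
        "b \<in> set (sorted_list_of_set (signed_block n C t))"
    then have s: "1 \<le> s" "s \<le> card C + 1" and t: "1 \<le> t" "t \<le> card C" by auto
    have "\<bar>a\<bar> \<in> block n C s" "\<bar>b\<bar> \<in> block n C t"
      using ab finite_signed_block[OF C] abs_signed_block[OF C] s t by auto
    then have "\<bar>b\<bar> \<in> supp n (chain_elem C t)" "\<bar>a\<bar> \<notin> supp n (chain_elem C t)"
      using chain_level_block[OF C, of t b t] chain_level_block[OF C, of s a t] s t \<open>t < s\<close> by auto
    then have "chain_level n C a < chain_level n C b"
      using chain_level_less_iff[OF C] chain_elem_in[OF C t] by blast
    then show "chain_prec n C a b" by (simp add: chain_prec_def)
  qed
qed

lemma set_Phi_word: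
  assumes C: "sv_chain n C"
  shows "set (Phi_word n C) = signed_set n (BAR n (chain_top C))"
proof -
  have "set (Phi_word n C) = (\<Union>s\<in>{1..card C + 1}. signed_block n C s)"
    unfolding Phi_word_def using finite_signed_block[OF C]
    by (auto simp: less_Suc_eq_le simp del: upt_Suc)
  also have "\<dots> = signed_set n (BAR n (chain_top C))"
  proof -
    have "(\<Union>s\<in>{1..card C + 1}. block n C s) = {1..int n}"
    proof
      show "(\<Union>s\<in>{1..card C + 1}. block n C s) \<subseteq> {1..int n}"
        using block_subset[OF C] by (intro UN_least) auto
      show "{1..int n} \<subseteq> (\<Union>s\<in>{1..card C + 1}. block n C s)"
        by (rule subsetI, erule Union_block[OF C]) auto
    qed
    then have "i \<in> {1..int n} \<longleftrightarrow> (\<exists>s\<in>{1..card C + 1}. i \<in> block n C s)" for i by blast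
    then show ?thesis
      unfolding signed_block_def signed_set_def Let_def by blast
  qed
  finally show ?thesis .
qed

text \<open>Computing the window reduces to checking its letters and its order, as
  \<open>chain_prec\<close> is asymmetric.\<close>

lemma Phi_word_eqI:
  assumes "sv_chain n C" "sorted_wrt (chain_prec n C) w" "set w = signed_set n (BAR n (chain_top C))"
  shows "Phi_word n C = w"
  by (rule sorted_wrt_set_unique[OF sorted_Phi_word[OF assms(1)] assms(2)])
    (use assms set_Phi_word in \<open>auto dest: chain_prec_asym\<close>)


section \<open>The interval of a signed permutation\<close>

text \<open>A window together with a zero-free vector whose flips are the positions of its negative
  letters. Fixing this vector replaces the definite description in \<open>theta\<close>.\<close>

locale signed_word =
  fixes n :: nat and \<theta> :: sign_vector and w :: "int list"
  assumes n: "n \<ge> 1" and \<theta>: "\<theta> \<in> sign_vectors n" "\<forall>i\<in>{1..int n}. \<theta> i \<noteq> 0"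
    and distinct_w: "distinct w" and set_w: "set w = signed_set n (sv_BAR n \<theta>)"
begin

lemma signed_set_eq: "signed_set n B = (\<lambda>i. if i \<in> B then - i else i) ` {1..int n}"
  by (auto simp: signed_set_def)

lemma abs_set_w: "abs ` set w = {1..int n}"
  unfolding set_w signed_set_eq image_image by (auto simp: image_iff)

lemma inj_abs_w: "inj_on abs (set w)"
  unfolding set_w signed_set_eq by (auto simp: inj_on_def)

lemma length_w: "length w = n"
proof -
  have "length w = card (abs ` set w)"
    using distinct_card[OF distinct_w] card_image[OF inj_abs_w] by simp
  then show ?thesis unfolding abs_set_w by simp
qed

lemma of_window_nth: "k < n \<Longrightarrow> of_window w (int k + 1) = w ! k"
  by (simp add: of_window_def length_w nat_add_distrib)

lemma negative_w: "a \<in> set w \<Longrightarrow> a < 0 \<longleftrightarrow> \<bar>a\<bar> \<in> sv_BAR n \<theta>"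
  unfolding set_w signed_set_eq by (auto split: if_splits)

lemma negative_values:
  "{\<bar>of_window w i\<bar> |i. i \<in> {1..int n} \<and> of_window w i < 0} = sv_BAR n \<theta>"
proof -
  have "of_window w ` {1..int n} = set w"
    using arg_cong[OF map_of_window[of w], of set] by (simp add: length_w)
  have "{\<bar>of_window w i\<bar> |i. i \<in> {1..int n} \<and> of_window w i < 0} = abs ` {a \<in> set w. a < 0}"
    unfolding \<open>of_window w ` {1..int n} = set w\<close>[symmetric] by blast
  also have "\<dots> = {b \<in> abs ` set w. b \<in> sv_BAR n \<theta>}"
    using negative_w by blast
  also have "\<dots> = sv_BAR n \<theta>"
    unfolding abs_set_w using BAR_subset by blast
  finally show ?thesis .
qed

lemma sv_supp_\<theta>: "sv_supp n \<theta> = {1..int n}"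
  using \<theta>(2) by (auto simp: sv_supp_def)

lemma theta_of_window: "theta n (of_window w) = sv_class \<theta>"
  unfolding theta_def negative_values
proof (rule the_equality)
  have "\<theta> 1 \<noteq> 0" using \<theta>(2) n by auto
  then have "\<theta> \<noteq> zero_sv" by (auto simp: zero_sv_def)
  then show "sv_class \<theta> \<in> PV n \<and> supp n (sv_class \<theta>) = {1..int n} \<and>
      BAR n (sv_class \<theta>) = sv_BAR n \<theta>"
    using \<theta>(1) by (auto simp: PV_eq sv_supp_\<theta>)
next
  fix x assume x: "x \<in> PV n \<and> supp n x = {1..int n} \<and> BAR n x = sv_BAR n \<theta>"
  then obtain \<eta> where \<eta>: "\<eta> \<in> sign_vectors n" "x = sv_class \<eta>" by (auto simp: PV_eq)
  then have "\<forall>i\<in>{1..int n}. \<eta> i \<noteq> 0" using x by (auto simp: sv_supp_def)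
  then have "\<eta> = \<theta> \<or> \<eta> = (\<lambda>i. - \<theta> i)"
    using sv_eq_if_BAR_eq[OF n \<theta> \<eta>(1)] \<eta>(2) x by simp
  then show "x = sv_class \<theta>" using \<eta>(2) by (auto simp: sv_class_uminus)
qed

section \<open>Tails of the window and the upper chain\<close>

definition tail_supp :: "nat \<Rightarrow> int set" where
  "tail_supp j = abs ` set (drop (n - j) w)"

lemma tail_supp_subset: "tail_supp j \<subseteq> {1..int n}"
  using abs_set_w set_drop_subset[of "n - j" w] by (auto simp: tail_supp_def)

lemma tail_supp_0: "tail_supp 0 = {}"
  by (simp add: tail_supp_def length_w)

lemma tail_supp_mono: "j \<le> k \<Longrightarrow> tail_supp j \<subseteq> tail_supp k"
  unfolding tail_supp_def by (intro image_mono set_drop_subset_set_drop) simp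

lemma card_tail_supp: "j \<le> n \<Longrightarrow> card (tail_supp j) = j"
proof -
  assume j: "j \<le> n"
  have "card (tail_supp j) = card (set (drop (n - j) w))"
    unfolding tail_supp_def using inj_abs_w set_drop_subset[of "n - j" w]
    by (intro card_image) (rule inj_on_subset)
  also have "\<dots> = length (drop (n - j) w)"
    using distinct_w by (intro distinct_card) simp
  finally show ?thesis using j by (simp add: length_w)
qed

lemma abs_nth_eq_iff: "k < n \<Longrightarrow> l < n \<Longrightarrow> \<bar>w ! k\<bar> = \<bar>w ! l\<bar> \<longleftrightarrow> k = l"
  using inj_on_eq_iff[OF inj_abs_w] nth_eq_iff_index_eq[OF distinct_w] by (simp add: length_w)

lemma set_drop_nth: "set (drop k xs) = (!) xs ` {k..<length xs}"
  by (auto simp: set_conv_nth image_iff) (metis le_add_diff_inverse diff_less_mono)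

lemma abs_nth_in_tail_supp: "k < n \<Longrightarrow> \<bar>w ! k\<bar> \<in> tail_supp j \<longleftrightarrow> n - j \<le> k"
  unfolding tail_supp_def set_drop_nth using abs_nth_eq_iff by (auto simp: length_w image_image)

text \<open>The indices from 1 to n give the elements of the upper chain. Index 0 gives the class of
  the zero vector, which is the top of the empty chain.\<close>

definition tail_class :: "nat \<Rightarrow> sign_vector set" where
  "tail_class j = sv_class (sv_restrict (tail_supp j) \<theta>)"

lemma supp_tail_class: "supp n (tail_class j) = tail_supp j"
  using tail_supp_subset by (auto simp: tail_class_def sv_supp_\<theta>)

lemma upper_elem_of_window: "j \<le> n \<Longrightarrow> upper_elem n (of_window w) j = tail_class j"
proof -
  assume j: "j \<le> n"
  \<comment> \<open>List positions start at 0, the arguments of \<open>of_window\<close> at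
    1.\<close>
  have shift: "(\<lambda>k. int k + 1) ` {n - j..<n} = {int n - int j + 1..int n}"
  proof (rule set_eqI)
    fix i show "i \<in> (\<lambda>k. int k + 1) ` {n - j..<n} \<longleftrightarrow> i \<in> {int n - int j + 1..int n}"
      using j by (auto intro!: image_eqI[of _ _ "nat (i - 1)"])
  qed
  have "(\<lambda>k. \<bar>of_window w k\<bar>) ` {int n - int j + 1..int n} = tail_supp j"
    unfolding shift[symmetric] tail_supp_def set_drop_nth image_image
    by (rule image_cong) (simp_all add: length_w of_window_nth)
  then show ?thesis
    unfolding upper_elem_def theta_of_window restrict_class_sv_class tail_class_def by simp
qed

lemma upper_chain_of_window: "upper_chain n (of_window w) = tail_class ` {1..n}"
  unfolding upper_chain_def by (rule image_cong) (simp_all add: upper_elem_of_window)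

lemma tail_class_inj: "inj_on tail_class {..n}"
proof (rule inj_onI)
  fix j k assume "j \<in> {..n}" "k \<in> {..n}" "tail_class j = tail_class k"
  then show "j = k" using card_tail_supp supp_tail_class by (metis atMost_iff)
qed

lemma card_upper_chain: "card (upper_chain n (of_window w)) = n"
  unfolding upper_chain_of_window
  by (subst card_image) (auto intro: inj_on_subset[OF tail_class_inj])

lemma tail_class_PV:
  assumes "1 \<le> j" "j \<le> n" shows "tail_class j \<in> PV n"
proof -
  have "tail_supp j \<noteq> {}" using card_tail_supp[OF assms(2)] assms(1) by auto
  then have "sv_restrict (tail_supp j) \<theta> \<noteq> zero_sv"
    using supp_tail_class[of j] sv_class_zero unfolding tail_class_def by force
  then show ?thesis
    using sv_restrict_in_sign_vectors[OF \<theta>(1)] by (auto simp: PV_eq tail_class_def)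
qed

lemma sv_chain_upper_chain: "sv_chain n (upper_chain n (of_window w))"
proof -
  have "sv_less (tail_class j) (tail_class k)" if "j < k" "k \<le> n" for j k
    unfolding tail_class_def
  proof (rule sv_less_restrictI)
    show "tail_supp j \<subset> tail_supp k"
      using tail_supp_mono[of j k] card_tail_supp[of j] card_tail_supp[of k] that by auto
    show "tail_supp k \<subseteq> sv_supp n \<theta>"
      using tail_supp_subset sv_supp_\<theta> by auto
  qed
  then have "sv_less (tail_class j) (tail_class k) \<or> tail_class j = tail_class k \<or>
      sv_less (tail_class k) (tail_class j)" if "j \<le> n" "k \<le> n" for j k
    using that by (cases j k rule: linorder_cases) auto
  then show ?thesis
    unfolding sv_chain_iff upper_chain_of_window using tail_class_PV by auto
qed

lemma upper_chain_in_order_complex: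
  assumes "sv_var n \<theta> \<le> m" shows "upper_chain n (of_window w) \<in> order_complex n m"
proof -
  have "\<forall>\<omega>\<in>tail_class j. sv_var n \<omega> \<le> m" for j
    using sv_var_restrict_le[OF \<theta>(1), of "tail_supp j"] assms
    by (auto simp: tail_class_def sv_class_def sv_var_uminus)
  then show ?thesis
    using sv_chain_upper_chain unfolding order_complex_iff sign_poset_def
    by (auto simp: upper_chain_of_window tail_class_PV)
qed

section \<open>Descents and the lower chain\<close>

lemma Des_of_window:
  "i \<in> Des n (of_window w) \<longleftrightarrow> i < n \<and> (if i = 0 then w ! 0 < 0 else w ! i < w ! (i - 1))"
proof (cases "i < n")
  case True
  have "of_window w (int i) = w ! (i - 1)" if "i \<noteq> 0"
    using of_window_nth[of "i - 1"] that True by (simp add: of_nat_diff)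
  moreover have "of_window w (int (i + 1)) = w ! i"
    using of_window_nth[OF True] by (simp add: add.commute)
  ultimately show ?thesis by (auto simp: Des_def Let_def)
qed (simp add: Des_def)

text \<open>Weights identify indices: a descent i selects the tail that starts at list position i,
  just behind the descent.\<close>

lemma lower_chain_of_window:
  "lower_chain n (of_window w) = tail_class ` (\<lambda>i. n - i) ` Des n (of_window w)"
proof -
  have "wt n (tail_class j) = j" if "j \<le> n" for j
    using card_tail_supp[OF that] by (simp add: wt_def supp_tail_class)
  moreover have "(\<lambda>i. n - i) ` Des n (of_window w) \<subseteq> {1..n}"
    by (auto simp: Des_of_window)
  ultimately show ?thesis
    unfolding lower_chain_def upper_chain_of_window by fastforce
qed

lemma card_lower_chain: "card (lower_chain n (of_window w)) = des n (of_window w)"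
proof -
  have "inj_on (\<lambda>i. n - i) (Des n (of_window w))"
    by (auto simp: inj_on_def Des_of_window)
  moreover have "inj_on tail_class ((\<lambda>i. n - i) ` Des n (of_window w))"
    by (rule inj_on_subset[OF tail_class_inj]) auto
  ultimately show ?thesis
    unfolding lower_chain_of_window des_def by (simp add: card_image)
qed

lemma lower_subset_upper: "lower_chain n (of_window w) \<subseteq> upper_chain n (of_window w)"
  by (auto simp: lower_chain_def)

text \<open>Levels do not decrease along \<open>w\<close>, so every support is a tail and C lies in
  the upper chain. At a descent the value drops, so the level must jump; some element of C separates
  the two letters, and only one tail does so.\<close>

lemma mem_interval_if_sorted:
  assumes C: "sv_chain n C" and sorted: "sorted_wrt (chain_prec n C) w"
    and restrict: "\<And>x. x \<in> C \<Longrightarrow> x = sv_class (sv_restrict (supp n x) \<theta>)"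
    and BAR: "sv_BAR n \<theta> \<subseteq> supp n (chain_top C)"
  shows "lower_chain n (of_window w) \<subseteq> C" "C \<subseteq> upper_chain n (of_window w)"
proof -
  have tail: "\<exists>j\<in>{1..n}. x = tail_class j" if x: "x \<in> C" for x
  proof -
    \<comment> \<open>The support begins at the first list position whose letter it contains; n is a
      sentinel that makes the minimum exist.\<close>
    define P where "P k \<longleftrightarrow> k = n \<or> \<bar>w ! k\<bar> \<in> supp n x" for k
    define k where "k = (LEAST k. P k)"
    have "P n" by (simp add: P_def)
    then have k: "P k" "k \<le> n" and below: "\<not> P l" if "l < k" for l
      using that not_less_Least unfolding k_def by (auto intro: LeastI Least_le)
    have P_iff: "\<bar>w ! l\<bar> \<in> supp n x \<longleftrightarrow> k \<le> l" if l: "l < n" for l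
    proof
      assume "\<bar>w ! l\<bar> \<in> supp n x"
      then show "k \<le> l" using below[of l] by (auto simp: P_def not_less[symmetric])
    next
      have "P k" "k \<le> n" using \<open>P n\<close> unfolding k_def by (auto intro: LeastI Least_le)
      assume "k \<le> l"
      show "\<bar>w ! l\<bar> \<in> supp n x"
      proof (cases "k = l")
        case True
        then show ?thesis using \<open>P k\<close> l by (auto simp: P_def)
      next
        case False
        then have "k < l" using \<open>k \<le> l\<close> by simp
        then have "chain_prec n C (w ! k) (w ! l)"
          using sorted l by (simp add: sorted_wrt_iff_nth_less length_w)
        then have "\<not> chain_level n C (w ! l) < chain_level n C (w ! k)"
          by (auto simp: chain_prec_def)
        moreover have "\<bar>w ! k\<bar> \<in> supp n x" using \<open>P k\<close> \<open>k < l\<close> l by (auto simp: P_def)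
        ultimately show ?thesis using chain_level_less_iff[OF C] x by blast
      qed
    qed
    have x_PV: "x \<in> PV n" using C x by (auto simp: sv_chain_iff)
    have "k \<le> n" using \<open>P n\<close> unfolding k_def by (rule Least_le)
    have "supp n x = tail_supp (n - k)"
    proof (rule set_eqI)
      fix i show "i \<in> supp n x \<longleftrightarrow> i \<in> tail_supp (n - k)"
      proof (cases "i \<in> {1..int n}")
        case True
        then obtain l where "l < n" "i = \<bar>w ! l\<bar>"
          unfolding abs_set_w[symmetric] by (auto simp: in_set_conv_nth length_w)
        then show ?thesis using P_iff abs_nth_in_tail_supp \<open>k \<le> n\<close> by simp
      qed (use supp_PV_subset[OF x_PV] tail_supp_subset in blast)
    qed
    moreover have "supp n x \<noteq> {}"
      using x_PV sv_supp_eq_empty_iff by (auto simp: PV_eq)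
    ultimately show ?thesis
      using restrict[OF x] tail_supp_0 unfolding tail_class_def
      by (intro bexI[of _ "n - k"]) (auto simp: Suc_le_eq intro: ccontr)
  qed
  show "C \<subseteq> upper_chain n (of_window w)"
    using tail unfolding upper_chain_of_window by blast
  show "lower_chain n (of_window w) \<subseteq> C"
    unfolding lower_chain_of_window
  proof (intro image_subsetI, elim imageE)
    fix j i assume j: "j = n - i" and i: "i \<in> Des n (of_window w)"
    then have "i < n" by (simp add: Des_of_window)
    show "tail_class j \<in> C"
    proof (cases "i = 0")
      \<comment> \<open>A descent at 0 means that the first letter is negative. Its position is a
        flip and so lies in the support of the top, which is then the full tail.\<close>
      case True
      then have "w ! 0 < 0" using i by (simp add: Des_of_window)
      then have "\<bar>w ! 0\<bar> \<in> supp n (chain_top C)"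
        using negative_w[of "w ! 0"] nth_mem[of 0 w] BAR n length_w by auto
      moreover from this have "chain_top C \<noteq> {zero_sv}" by auto
      then have "chain_top C \<in> C" using chain_top_cases[OF C] by blast
      ultimately have top: "chain_top C \<in> C" "\<bar>w ! 0\<bar> \<in> supp n (chain_top C)" by auto
      then obtain l where l: "l \<in> {1..n}" "chain_top C = tail_class l" using tail by blast
      then have "n - l \<le> 0" using top(2) abs_nth_in_tail_supp[of 0 l] n by (simp add: supp_tail_class)
      then show ?thesis using l top(1) j True by simp
    next
      case False
      then have "w ! i < w ! (i - 1)" using i by (simp add: Des_of_window)
      moreover have "chain_prec n C (w ! (i - 1)) (w ! i)"
        using sorted False \<open>i < n\<close> by (simp add: sorted_wrt_iff_nth_less length_w)
      ultimately have "chain_level n C (w ! (i - 1)) < chain_level n C (w ! i)"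
        by (simp add: chain_prec_def)
      then obtain x where x: "x \<in> C" "\<bar>w ! i\<bar> \<in> supp n x" "\<bar>w ! (i - 1)\<bar> \<notin> supp n x"
        using chain_level_less_iff[OF C] by blast
      then obtain l where l: "l \<in> {1..n}" "x = tail_class l" using tail by blast
      \<comment> \<open>A tail containing position i but not position i - 1 starts exactly at
        i.\<close>
      then have "n - l \<le> i" "\<not> n - l \<le> i - 1"
        using x abs_nth_in_tail_supp[of i l] abs_nth_in_tail_supp[of "i - 1" l] \<open>i < n\<close>
        by (simp_all add: supp_tail_class)
      then have "l = j" using j l \<open>i < n\<close> by auto
      then show ?thesis using l x by simp
    qed
  qed
qed

text \<open>The top of C contains the tails behind all descents and hence all negative letters; its
  restriction keeps the flips, and the letters of \<open>w\<close> are the right ones. Sortedness is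
  checked for neighbours: without a jump of level there is no descent.\<close>

lemma Phi_eq_if_mem_interval:
  assumes lower: "lower_chain n (of_window w) \<subseteq> C" and upper: "C \<subseteq> upper_chain n (of_window w)"
  shows "Phi n C = of_window w"
proof -
  have C: "sv_chain n C"
    using sv_chain_upper_chain upper unfolding sv_chain_iff by blast
  have tail: "\<exists>j\<in>{1..n}. x = tail_class j" if "x \<in> C" for x
    using that upper unfolding upper_chain_of_window by blast
  have Des_mem: "tail_class (n - i) \<in> C" if "i \<in> Des n (of_window w)" for i
    using that lower unfolding lower_chain_of_window by blast
  obtain j where j: "j \<le> n" "chain_top C = tail_class j"
  proof (rule chain_top_cases[OF C])
    assume "chain_top C = {zero_sv}"
    then show ?thesis
      by (intro that[of 0]) (simp_all add: tail_class_def tail_supp_0 sv_restrict_empty sv_class_zero)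
  next
    assume "chain_top C \<in> C"
    then obtain j where "j \<in> {1..n}" "chain_top C = tail_class j" using tail by blast
    then show ?thesis by (intro that[of j]) auto
  qed
  have Des_ge: "n - j \<le> i" if "i \<in> Des n (of_window w)" for i
  proof -
    have "tail_supp (n - i) \<subseteq> tail_supp j"
      using supp_subset_chain_top[OF C Des_mem[OF that]] j by (simp add: supp_tail_class)
    then have "card (tail_supp (n - i)) \<le> card (tail_supp j)"
      using tail_supp_subset by (intro card_mono) (auto intro: finite_subset)
    then show ?thesis using card_tail_supp j by simp
  qed
  \<comment> \<open>In front of the tail of the top there is no descent, not even at 0, so these
    letters ascend from a nonnegative one.\<close>
  have pos: "w ! k \<ge> 0" if "k < n - j" for k
    using that
  proof (induction k)
    case 0
    then show ?case using Des_ge[of 0] by (cases "w ! 0 < 0") (auto simp: Des_of_window)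
  next
    case (Suc k)
    then have "Suc k \<notin> Des n (of_window w)" "Suc k < n" using Des_ge[of "Suc k"] by auto
    then show ?case using Suc by (auto simp: Des_of_window)
  qed
  have BAR_subset_tail: "sv_BAR n \<theta> \<subseteq> tail_supp j"
  proof
    fix b assume b: "b \<in> sv_BAR n \<theta>"
    then have "b \<in> abs ` set w" using BAR_subset abs_set_w by blast
    then obtain k where k: "k < n" "b = \<bar>w ! k\<bar>" by (auto simp: in_set_conv_nth length_w)
    then have "w ! k < 0" using negative_w[of "w ! k"] b length_w by simp
    then have "n - j \<le> k" using pos[of k] by (auto simp: not_less[symmetric])
    then show "b \<in> tail_supp j" using abs_nth_in_tail_supp k by simp
  qed
  have "BAR n (chain_top C) = sv_BAR n \<theta>"
    using BAR_cyclic_fill[OF n cyclic_fill_restrict[OF n \<theta> BAR_subset_tail]] j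
    by (simp add: tail_class_def)
  moreover have "sorted_wrt (chain_prec n C) w"
    unfolding sorted_wrt_iff_nth_Suc_transp[OF transp_chain_prec]
  proof (intro allI impI)
    fix i assume i: "Suc i < length w"
    \<comment> \<open>Exactly one tail separates two neighbouring letters, the one starting at the
      second of them.\<close>
    have separated: "l = n - Suc i \<longleftrightarrow> \<bar>w ! Suc i\<bar> \<in> tail_supp l \<and> \<bar>w ! i\<bar> \<notin> tail_supp l"
      if "l \<in> {1..n}" for l
      using abs_nth_in_tail_supp[of i l] abs_nth_in_tail_supp[of "Suc i" l] i that length_w by auto
    have "\<not> chain_level n C (w ! Suc i) < chain_level n C (w ! i)"
    proof
      assume "chain_level n C (w ! Suc i) < chain_level n C (w ! i)"
      then obtain l where "l \<in> {1..n}" "\<bar>w ! i\<bar> \<in> tail_supp l" "\<bar>w ! Suc i\<bar> \<notin> tail_supp l"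
        unfolding chain_level_less_iff[OF C] using tail supp_tail_class by metis
      then show False
        using abs_nth_in_tail_supp[of i l] abs_nth_in_tail_supp[of "Suc i" l] i length_w by auto
    qed
    moreover have "w ! i < w ! Suc i" if eq: "chain_level n C (w ! i) = chain_level n C (w ! Suc i)"
    proof -
      have "Suc i \<notin> Des n (of_window w)"
      proof
        assume "Suc i \<in> Des n (of_window w)"
        then have "tail_class (n - Suc i) \<in> C" by (rule Des_mem)
        moreover have "\<bar>w ! Suc i\<bar> \<in> tail_supp (n - Suc i)" "\<bar>w ! i\<bar> \<notin> tail_supp (n - Suc i)"
          using separated[of "n - Suc i"] i length_w by auto
        ultimately have "chain_level n C (w ! i) < chain_level n C (w ! Suc i)"
          unfolding chain_level_less_iff[OF C] using supp_tail_class by blast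
        then show False using eq by simp
      qed
      then have "w ! i \<le> w ! Suc i" using i length_w by (auto simp: Des_of_window)
      moreover have "w ! i \<noteq> w ! Suc i" using i distinct_w by (simp add: nth_eq_iff_index_eq)
      ultimately show ?thesis by simp
    qed
    ultimately show "chain_prec n C (w ! i) (w ! Suc i)"
      unfolding chain_prec_def by linarith
  qed
  ultimately have "Phi_word n C = w"
    by (intro Phi_word_eqI[OF C]) (simp_all add: set_w)
  then show ?thesis by (simp add: Phi_eq)
qed

end


section \<open>Partitions and h-vectors\<close>

text \<open>The vector \<theta> is a filling of a representative of the top. Here the condition on m
  enters: \<open>sv_var_cyclic_fill_le\<close> handles even m, and \<open>sv_var_le\<close> handles
  m = n - 1.\<close>

lemma chain_gives_signed_word:
  assumes "n \<ge> 1" "m \<le> n - 1" "even m \<or> m = n - 1" and C: "C \<in> order_complex n m"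
  obtains \<theta> where "signed_word n \<theta> (Phi_word n C)" "sv_var n \<theta> \<le> m"
    "sv_BAR n \<theta> \<subseteq> supp n (chain_top C)"
    "\<And>x. x \<in> C \<Longrightarrow> x = sv_class (sv_restrict (supp n x) \<theta>)"
proof -
  have chain: "sv_chain n C" and poset: "C \<subseteq> sign_poset n m"
    using C by (simp_all add: order_complex_iff)
  obtain \<omega> where \<omega>: "\<omega> \<in> sign_vectors n" "chain_top C = sv_class \<omega>" "sv_var n \<omega> \<le> m"
  proof (rule chain_top_cases[OF chain])
    assume "chain_top C = {zero_sv}"
    moreover have "sv_entries zero_sv is = []" for "is" by (induction "is") (auto simp: zero_sv_def)
    then have "sv_var n zero_sv = 0" by (simp add: sv_var_eq)
    moreover have "zero_sv \<in> sign_vectors n" by (simp add: sign_vectors_def zero_sv_def)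
    ultimately show ?thesis by (intro that[of zero_sv]) (simp_all add: sv_class_zero)
  next
    assume "chain_top C \<in> C"
    then show ?thesis using poset that unfolding sign_poset_eq by blast
  qed
  obtain \<theta> where fill: "cyclic_fill n \<omega> \<theta>"
    using cyclic_fill_exists[OF \<open>n \<ge> 1\<close> \<omega>(1)] .
  have BAR: "sv_BAR n \<theta> = sv_BAR n \<omega>"
    by (rule BAR_cyclic_fill[OF \<open>n \<ge> 1\<close> fill])
  have \<theta>: "\<theta> \<in> sign_vectors n" "\<forall>i\<in>{1..int n}. \<theta> i \<noteq> 0"
    using fill unfolding cyclic_fill_def by blast+
  have irrefl: "\<not> chain_prec n C a a" for a by (simp add: chain_prec_def)
  have "distinct (Phi_word n C)"
    using sorted_wrt_irrefl_distinct[OF sorted_Phi_word[OF chain]] irrefl by blast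
  moreover have "set (Phi_word n C) = signed_set n (sv_BAR n \<theta>)"
    using set_Phi_word[OF chain] \<omega>(2) BAR by simp
  ultimately have "signed_word n \<theta> (Phi_word n C)"
    using \<open>n \<ge> 1\<close> \<theta> by unfold_locales
  moreover have "sv_var n \<theta> \<le> m"
    using assms(3)
  proof
    assume "even m"
    then show ?thesis using sv_var_cyclic_fill_le[OF \<open>n \<ge> 1\<close> \<omega>(1) fill] \<omega>(3) by blast
  qed (use sv_var_le[OF \<open>n \<ge> 1\<close>] in simp)
  moreover have "sv_BAR n \<theta> \<subseteq> supp n (chain_top C)"
    unfolding BAR \<omega>(2) by (auto simp: sv_BAR_def sv_supp_def)
  moreover have "x = sv_class (sv_restrict (supp n x) \<theta>)" if "x \<in> C" for x
  proof -
    \<comment> \<open>Filling does not alter the nonzero entries of \<omega>, so the elements of C,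
      which are restrictions of \<omega>, are also restrictions of \<theta>.\<close>
    have "sv_restrict (sv_supp n \<omega>) \<theta> i = \<omega> i" for i
      using fill \<omega>(1) by (cases "i \<in> {1..int n}")
        (auto simp: sv_restrict_def sv_supp_def cyclic_fill_def sign_vectors_def)
    then have "sv_restrict (supp n x) \<omega> = sv_restrict (supp n x) (sv_restrict (sv_supp n \<omega>) \<theta>)"
      by (simp add: sv_restrict_def)
    also have "\<dots> = sv_restrict (supp n x) \<theta>"
      using supp_subset_chain_top[OF chain that] \<omega>(2) by (simp add: sv_restrict_restrict Int_absorb2)
    finally show ?thesis using chain_eq_restrict_top[OF chain that \<omega>(2,1)] by simp
  qed
  ultimately show ?thesis by (rule that)
qed

section \<open>Counting faces of Boolean intervals\<close>

lemma card_between: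
  assumes "A \<subseteq> B" "finite B"
  shows "card {F \<in> {A..B}. card F = i} =
    (if card A \<le> i then (card B - card A) choose (i - card A) else 0)"
proof (cases "card A \<le> i")
  case True
  have "finite A" using assms finite_subset by blast
  have "bij_betw (\<lambda>F. A \<union> F) {F. F \<subseteq> B - A \<and> card F = i - card A} {F \<in> {A..B}. card F = i}"
  proof (rule bij_betw_byWitness[where f' = "\<lambda>F. F - A"])
    show "(\<lambda>F. A \<union> F) ` {F. F \<subseteq> B - A \<and> card F = i - card A} \<subseteq> {F \<in> {A..B}. card F = i}"
    proof (intro image_subsetI)
      fix F assume F: "F \<in> {F. F \<subseteq> B - A \<and> card F = i - card A}"
      then have "finite F" using assms(2) finite_subset by blast
      then have "card (A \<union> F) = card A + card F"
        using F \<open>finite A\<close> by (intro card_Un_disjoint) auto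
      then show "A \<union> F \<in> {F \<in> {A..B}. card F = i}" using F True assms(1) by auto
    qed
    show "(\<lambda>F. F - A) ` {F \<in> {A..B}. card F = i} \<subseteq> {F. F \<subseteq> B - A \<and> card F = i - card A}"
      using \<open>finite A\<close> by (auto simp: card_Diff_subset)
  qed auto
  then have "card {F \<in> {A..B}. card F = i} = card {F. F \<subseteq> B - A \<and> card F = i - card A}"
    using bij_betw_same_card by fastforce
  also have "\<dots> = card (B - A) choose (i - card A)"
    using assms(2) by (intro n_subsets) auto
  finally show ?thesis using True card_Diff_subset[OF \<open>finite A\<close> assms(1)] by simp
next
  case False
  have "\<not> (A \<subseteq> F \<and> F \<subseteq> B \<and> card F = i)" for F
    using card_mono[of F A] finite_subset[of F B] assms(2) False by blast
  then have "{F \<in> {A..B}. card F = i} = {}" by auto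
  then show ?thesis using False by (metis card.empty)
qed

text \<open>This is the contribution to the k-th h-number of one Boolean interval from a d-set to an
  n-set. For d \<le> k it is a multiple of (1 - 1)^(k - d), so only k = d counts.\<close>

lemma alternating_binomial_convolution:
  assumes "d \<le> n" "k \<le> n"
  shows "(\<Sum>i=0..k. (-1) ^ (k - i) * int ((n - i) choose (k - i)) *
           int (if d \<le> i then (n - d) choose (i - d) else 0)) = (if d = k then 1 else 0)"
    (is "?S = _")
proof (cases "d \<le> k")
  case True
  define N where "N = n - d"
  define K where "K = k - d"
  have KN: "K \<le> N" using assms by (simp add: N_def K_def)
  have "?S = (\<Sum>i=d..k. (-1) ^ (k - i) * int ((n - i) choose (k - i)) * int ((n - d) choose (i - d)))"
    by (rule sum.mono_neutral_cong_right) auto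
  also have "\<dots> = (\<Sum>l=0..K. (-1) ^ (K - l) * int ((N - l) choose (K - l)) * int (N choose l))"
    by (rule sum.reindex_bij_witness[of _ "\<lambda>l. l + d" "\<lambda>i. i - d"])
      (use True in \<open>auto simp: K_def N_def\<close>)
  also have "\<dots> = (\<Sum>l\<le>K. int (N choose K) * (int (K choose l) * 1 ^ l * (-1) ^ (K - l)))"
    unfolding atLeast0AtMost
  proof (rule sum.cong)
    fix l assume "l \<in> {..K}"
    \<comment> \<open>Choosing K elements and l among them is choosing the l first; this pulls a
      constant factor out of the sum and leaves a binomial expansion.\<close>
    then have "(N choose K) * (K choose l) = (N choose l) * ((N - l) choose (K - l))"
      using KN by (intro choose_mult) auto
    then have "int (N choose K) * int (K choose l) = int (N choose l) * int ((N - l) choose (K - l))"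
      by (metis of_nat_mult)
    then show "(-1) ^ (K - l) * int ((N - l) choose (K - l)) * int (N choose l) =
        int (N choose K) * (int (K choose l) * 1 ^ l * (-1) ^ (K - l))"
      by (simp add: mult_ac)
  qed simp
  also have "\<dots> = int (N choose K) * (1 + (-1)) ^ K"
    unfolding binomial_ring sum_distrib_left by simp
  also have "\<dots> = (if d = k then 1 else 0)"
    using True by (auto simp: K_def power_0_left)
  finally show ?thesis .
next
  case False
  then show ?thesis by (auto intro!: sum.neutral)
qed

text \<open>Face numbers add up over disjoint intervals and h-numbers are linear in them, so each
  interval contributes 1 at the size of its bottom. The index set is arbitrary, so that signed
  permutations can serve as indices.\<close>

lemma h_number_partition:
  assumes "finite P" "P \<noteq> {}"
    and \<Delta>: "\<Delta> = (\<Union>p\<in>P. {lo p..up p})" and disj: "disjoint_family_on (\<lambda>p. {lo p..up p}) P"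
    and lo: "\<And>p. p \<in> P \<Longrightarrow> lo p \<subseteq> up p"
    and up: "\<And>p. p \<in> P \<Longrightarrow> finite (up p)" "\<And>p. p \<in> P \<Longrightarrow> card (up p) = n"
    and "k \<le> n"
  shows "h_number \<Delta> k = int (card {p \<in> P. card (lo p) = k})"
proof -
  have card_lo: "card (lo p) \<le> n" if "p \<in> P" for p
    using card_mono[OF up(1) lo] up(2) that by metis
  have fin: "finite {lo p..up p}" if "p \<in> P" for p
    by (rule finite_subset[of _ "Pow (up p)"]) (use up(1) that in auto)
  have rank: "rank_of \<Delta> = n"
    unfolding rank_of_def
  proof (rule Max_eqI)
    show "finite (card ` \<Delta>)" unfolding \<Delta> using \<open>finite P\<close> fin by simp
    show "c \<le> n" if "c \<in> card ` \<Delta>" for c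
    proof -
      obtain p F where "p \<in> P" "F \<subseteq> up p" "c = card F" using \<open>c \<in> card ` \<Delta>\<close> unfolding \<Delta> by auto
      then show ?thesis using card_mono[OF up(1), of p F] up(2)[of p] by simp
    qed
    obtain p where "p \<in> P" using \<open>P \<noteq> {}\<close> by blast
    then show "n \<in> card ` \<Delta>" unfolding \<Delta> using lo up(2)[of p] by (intro image_eqI[of _ _ "up p"]) auto
  qed
  define g where "g d i = (if d \<le> i then (n - d) choose (i - d) else 0)" for d i :: nat
  have f: "f_number \<Delta> i = (\<Sum>p\<in>P. g (card (lo p)) i)" for i
  proof -
    have eq: "{F \<in> \<Delta>. card F = i} = (\<Union>p\<in>P. {F \<in> {lo p..up p}. card F = i})"
      unfolding \<Delta> by blast
    have dj: "disjoint_family_on (\<lambda>p. {F \<in> {lo p..up p}. card F = i}) P"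
      using disj unfolding disjoint_family_on_def by blast
    have fin_i: "finite {F \<in> {lo p..up p}. card F = i}" if "p \<in> P" for p
      by (rule finite_subset[OF _ fin[OF that]]) blast
    have "f_number \<Delta> i = (\<Sum>p\<in>P. card {F \<in> {lo p..up p}. card F = i})"
      unfolding f_number_def eq by (rule card_UN_disjoint'[OF dj fin_i \<open>finite P\<close>])
    also have "\<dots> = (\<Sum>p\<in>P. g (card (lo p)) i)"
      by (rule sum.cong) (simp_all only: card_between[OF lo up(1)] up(2) g_def)
    finally show ?thesis .
  qed
  have "h_number \<Delta> k =
      (\<Sum>i=0..k. \<Sum>p\<in>P. (-1) ^ (k - i) * int ((n - i) choose (k - i)) * int (g (card (lo p)) i))"
    unfolding h_number_def rank f by (simp add: sum_distrib_left)
  also have "\<dots> = (\<Sum>p\<in>P. \<Sum>i=0..k. (-1) ^ (k - i) * int ((n - i) choose (k - i)) * int (g (card (lo p)) i))"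
    by (rule sum.swap)
  also have "\<dots> = (\<Sum>p\<in>P. if card (lo p) = k then 1 else 0)"
    unfolding g_def by (intro sum.cong refl alternating_binomial_convolution card_lo \<open>k \<le> n\<close>)
  also have "\<dots> = int (card {p \<in> P. card (lo p) = k})"
    using \<open>finite P\<close> by (simp add: sum.If_cases Int_def)
  finally show ?thesis .
qed

text \<open>Each top lies in its own interval, so disjointness makes \<open>up\<close> injective,
  and each face lies below some top, so the facets are the tops. The inverse of \<open>up\<close>
  transports the bottoms from indices to facets.\<close>

lemma partitionableI:
  assumes \<Delta>: "\<Delta> = (\<Union>p\<in>P. {lo p..up p})" and disj: "disjoint_family_on (\<lambda>p. {lo p..up p}) P"
    and lo: "\<And>p. p \<in> P \<Longrightarrow> lo p \<subseteq> up p" and facet: "\<And>p. p \<in> P \<Longrightarrow> up p \<in> facets \<Delta>"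
  shows "partitionable \<Delta>"
proof -
  have inj: "inj_on up P"
  proof (rule inj_onI)
    fix p q assume pq: "p \<in> P" "q \<in> P" "up p = up q"
    then have "up p \<in> {lo p..up p} \<inter> {lo q..up q}" using lo[of p] lo[of q] by auto
    then show "p = q" using disj pq(1,2) unfolding disjoint_family_on_def by blast
  qed
  have facets: "facets \<Delta> = up ` P"
  proof
    show "facets \<Delta> \<subseteq> up ` P"
    proof
      fix F assume F: "F \<in> facets \<Delta>"
      then obtain p where p: "p \<in> P" "F \<subseteq> up p" unfolding facets_def \<Delta> by auto
      then have "up p = F" using F facet[OF p(1)] by (auto simp: facets_def)
      then show "F \<in> up ` P" using p(1) by blast
    qed
  qed (use facet in blast)
  define G where "G F = lo (the_inv_into P up F)" for F
  have G: "G (up p) = lo p" if "p \<in> P" for p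
    using the_inv_into_f_f[OF inj that] by (simp add: G_def)
  have "\<forall>F\<in>facets \<Delta>. G F \<subseteq> F"
    unfolding facets using G lo by auto
  moreover have "disjoint_family_on (\<lambda>F. {G F..F}) (facets \<Delta>)"
    unfolding facets disjoint_family_on_def
  proof (intro ballI impI)
    fix F F' assume "F \<in> up ` P" "F' \<in> up ` P" "F \<noteq> F'"
    then obtain p q where pq: "p \<in> P" "q \<in> P" "F = up p" "F' = up q" "p \<noteq> q" by blast
    then have "{lo p..up p} \<inter> {lo q..up q} = {}"
      using disj unfolding disjoint_family_on_def by blast
    then show "{G F..F} \<inter> {G F'..F'} = {}" using pq G by simp
  qed
  moreover have "(\<Union>F\<in>facets \<Delta>. {G F..F}) = \<Delta>"
    unfolding facets by (simp add: G \<Delta>)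
  ultimately show ?thesis unfolding partitionable_def by blast
qed

theorem theorem3p13:
  fixes n m :: nat
  assumes "n \<ge> 1" and "m \<le> n - 1" and "even m \<or> m = n - 1"
  shows "partitionable (order_complex n m) \<and>
         disjoint_family_on (\<lambda>\<pi>. {lower_chain n \<pi>..upper_chain n \<pi>}) (Phi n ` order_complex n m) \<and>
         order_complex n m = (\<Union>\<pi>\<in>Phi n ` order_complex n m. {lower_chain n \<pi>..upper_chain n \<pi>}) \<and>
         (\<forall>j\<le>n. h_number (order_complex n m) j =
                 int (card {\<pi> \<in> Phi n ` order_complex n m. des n \<pi> = j}))"
proof -
  define \<Delta> where "\<Delta> = order_complex n m"
  define P where "P = Phi n ` \<Delta>"
  \<comment> \<open>Applied to all faces, the first two facts say that the interval of
    \<open>Phi n C\<close> is the fibre of \<open>Phi\<close> through C.\<close>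
  have own: "C \<in> {lower_chain n (Phi n C)..upper_chain n (Phi n C)}"
    and Phi_unique: "\<And>D. D \<in> {lower_chain n (Phi n C)..upper_chain n (Phi n C)} \<Longrightarrow> Phi n D = Phi n C"
    and upper: "upper_chain n (Phi n C) \<in> \<Delta>" "card (upper_chain n (Phi n C)) = n"
    and lower: "lower_chain n (Phi n C) \<subseteq> upper_chain n (Phi n C)"
      "card (lower_chain n (Phi n C)) = des n (Phi n C)"
    if C: "C \<in> \<Delta>" for C
  proof -
    obtain \<theta> where "signed_word n \<theta> (Phi_word n C)" and props: "sv_var n \<theta> \<le> m"
      "sv_BAR n \<theta> \<subseteq> supp n (chain_top C)"
      "\<And>x. x \<in> C \<Longrightarrow> x = sv_class (sv_restrict (supp n x) \<theta>)"
      using chain_gives_signed_word[OF assms C[unfolded \<Delta>_def]] by metis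
    then interpret signed_word n \<theta> "Phi_word n C" by simp
    have chain: "sv_chain n C" using C by (simp add: \<Delta>_def order_complex_iff)
    show "C \<in> {lower_chain n (Phi n C)..upper_chain n (Phi n C)}"
      using mem_interval_if_sorted[OF chain sorted_Phi_word[OF chain] props(3,2)]
      by (simp add: Phi_eq)
    show "Phi n D = Phi n C" if "D \<in> {lower_chain n (Phi n C)..upper_chain n (Phi n C)}" for D
      using Phi_eq_if_mem_interval[of D] that by (simp add: Phi_eq[of n C])
    show "upper_chain n (Phi n C) \<in> \<Delta>" "card (upper_chain n (Phi n C)) = n"
      "lower_chain n (Phi n C) \<subseteq> upper_chain n (Phi n C)"
      "card (lower_chain n (Phi n C)) = des n (Phi n C)"
      using upper_chain_in_order_complex[OF props(1)] card_upper_chain lower_subset_upper card_lower_chain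
      by (simp_all add: Phi_eq \<Delta>_def)
  qed
  have down: "D \<in> \<Delta>" if "C \<in> \<Delta>" "D \<subseteq> C" for C D
    using that unfolding \<Delta>_def order_complex_def pred_on.chain_def by blast
  \<comment> \<open>Every face lies in its own interval, and the intervals stay inside the complex
    since subchains of faces are faces.\<close>
  have cover: "\<Delta> = (\<Union>\<pi>\<in>P. {lower_chain n \<pi>..upper_chain n \<pi>})"
    using own down[OF upper(1)] unfolding P_def by auto
  have disj: "disjoint_family_on (\<lambda>\<pi>. {lower_chain n \<pi>..upper_chain n \<pi>}) P"
    unfolding disjoint_family_on_def
  proof (intro ballI impI equals0I)
    fix \<pi> \<sigma> D
    assume "\<pi> \<in> P" "\<sigma> \<in> P" "\<pi> \<noteq> \<sigma>"
      and D: "D \<in> {lower_chain n \<pi>..upper_chain n \<pi>} \<inter> {lower_chain n \<sigma>..upper_chain n \<sigma>}"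
    then obtain C C' where "C \<in> \<Delta>" "\<pi> = Phi n C" "C' \<in> \<Delta>" "\<sigma> = Phi n C'"
      unfolding P_def by blast
    then show False using Phi_unique[of C D] Phi_unique[of C' D] D \<open>\<pi> \<noteq> \<sigma>\<close> by simp
  qed
  have finite_face: "finite C" if "C \<in> \<Delta>" for C
    using that finite_subset[OF _ finite_PV] by (auto simp: \<Delta>_def order_complex_iff sv_chain_iff)
  have "\<Delta> \<subseteq> Pow (PV n)" by (auto simp: \<Delta>_def order_complex_iff sv_chain_iff)
  then have "finite P" unfolding P_def using finite_subset finite_PV by blast
  have "{} \<in> \<Delta>" by (simp add: \<Delta>_def order_complex_def pred_on.chain_def)
  then have "P \<noteq> {}" by (auto simp: P_def)
  have lo: "lower_chain n \<pi> \<subseteq> upper_chain n \<pi>" and fin: "finite (upper_chain n \<pi>)"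
    and card: "card (upper_chain n \<pi>) = n" "card (lower_chain n \<pi>) = des n \<pi>" if "\<pi> \<in> P" for \<pi>
    using that lower upper finite_face by (auto simp: P_def)
  have "partitionable \<Delta>"
  proof (rule partitionableI[OF cover disj lo])
    fix \<pi> assume \<pi>: "\<pi> \<in> P"
    \<comment> \<open>F lies in some upper chain and so has at most n elements, as many as the upper
      chain it contains.\<close>
    have "F = upper_chain n \<pi>" if F: "F \<in> \<Delta>" "upper_chain n \<pi> \<subseteq> F" for F
    proof -
      have "card F \<le> n"
        using own[OF F(1)] card_mono[of "upper_chain n (Phi n F)" F] fin card F(1) by (auto simp: P_def)
      then show ?thesis using card_subset_eq[OF finite_face[OF F(1)] F(2)] card(1)[OF \<pi>]
          card_mono[OF finite_face[OF F(1)] F(2)] by simp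
    qed
    then show "upper_chain n \<pi> \<in> facets \<Delta>"
      using upper(1) \<pi> unfolding facets_def P_def by auto
  qed
  moreover have "h_number \<Delta> j = int (card {\<pi> \<in> P. des n \<pi> = j})" if "j \<le> n" for j
  proof -
    have "h_number \<Delta> j = int (card {\<pi> \<in> P. card (lower_chain n \<pi>) = j})"
      by (rule h_number_partition[OF \<open>finite P\<close> \<open>P \<noteq> {}\<close> cover disj lo fin card(1) that])
    also have "{\<pi> \<in> P. card (lower_chain n \<pi>) = j} = {\<pi> \<in> P. des n \<pi> = j}"
      using card(2) by auto
    finally show ?thesis .
  qed
  ultimately show ?thesis
    using cover disj unfolding P_def \<Delta>_def by blast
qed

end
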